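(* Fix $\lambda\in(0,e)$ and let $p\in(0,1)$ vary. For $p\in[0,1]$ let $F_\infty(p,\lambda)=\lim_{t\to\infty}e^{-t}\int_0^\infty x\,\mu_t(dx)$ denote the free energy of the continuous-time Derrida--Retaux model $(\mu_t)_{t\ge0}$ with initial distribution $\mu_0=p\,\delta_0+(1-p)\lambda e^{-\lambda x}\mathbf 1_{\{x>0\}}dx$. (i) If $\lambda\in(1,e)$, setting $p_c=\lambda-\lambda\log\lambda$, there exists $C>0$ such that $$F_\infty(p,\lambda)\sim \mathbf 1_{\{p<p_c\}}\,C\exp\big(-\pi\sqrt{2\lambda}\,(p_c-p)^{-1/2}\big)\qquad\text{as }p\uparrow p_c .$$ (ii) If $\lambda=1$, then $F_\infty(1,1)=0$ and there exists $C>0$ such that $$F_\infty(p,\lambda)\sim C(1-p)^{2/3}\exp\Big(-\frac{\pi}{\sqrt2}(1-p)^{-1/2}\Big)\qquad\text{as }p\uparrow1 .$$ (iii) If $\lambda\in(0,1)$, then $F_\infty(1,\lambda)=0$ and there exists $C>0$ such that $$F_\infty(p,\lambda)\sim C(1-p)^{1/(1-\lambda)}\qquad\text{as }p\uparrow1 .$$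
   Context: $f\sim g$ means that the ratio $f/g$ tends to $1$. The constants $C$ may depend on $\lambda$. A continuous-time Derrida--Retaux (DR) model with initial law $\mu_0$ (a probability distribution on $\mathbb{R}_+=[0,\infty)$) is a weakly continuous family $(\mu_t)_{t\ge0}$ of probability distributions on $\mathbb{R}$, starting from $\mu_0$, which is a weak solution of $\partial_t\mu_t=\partial_x(\mathbf 1_{\{x>0\}}\mu_t)+\mu_t*\mu_t-\mu_t$, meaning that for every bounded $\mathcal C^1$ function $f$ with bounded derivative and every $t>0$, $$\int_{\mathbb{R}} f\,d\mu_t-\int_{\mathbb{R}} f\,d\mu_0=\int_0^t\Big(-\int_{\mathbb{R}}\big(f'(x)\mathbf 1_{\{x>0\}}+f(x)\big)\mu_s(dx)+\int_{\mathbb{R}^2}f(x+y)\mu_s(dx)\mu_s(dy)\Big)ds .$$ For each $\mu_0$ on $\mathbb{R}_+$ there is exactly one DR model with initial law $\mu_0$, and it is supported on $\mathbb{R}_+$. *)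

theory Defs
  imports "HOL-Probability.Probability" "HOL-Library.Landau_Symbols"
begin

text \<open>
  A continuous-time Derrida--Retaux model \<open>\<mu>\<close> with initial law \<open>\<mu>0\<close>.  Only the values of \<open>\<mu>\<close>
  at times \<open>t \<ge> 0\<close> matter.  The last conjunct is the weak form of
  \<open>\<partial>\<^sub>t \<mu>\<^sub>t = \<partial>\<^sub>x (1\<^sub>{\<^sub>x\<^sub>>\<^sub>0\<^sub>} \<mu>\<^sub>t) + \<mu>\<^sub>t * \<mu>\<^sub>t - \<mu>\<^sub>t\<close>.  For test functions \<open>f\<close> as there, the integrand in \<open>s\<close>
  is bounded and, by the weak continuity, a pointwise limit of continuous functions of \<open>s\<close>, so the
  integral over \<open>{0..t}\<close> always exists.
\<close>

definition DR_model :: "real measure \<Rightarrow> (real \<Rightarrow> real measure) \<Rightarrow> bool" where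
  "DR_model \<mu>0 \<mu> \<longleftrightarrow>
     real_distribution \<mu>0 \<and> (AE x in \<mu>0. 0 \<le> x) \<and> \<mu> 0 = \<mu>0 \<and>
     (\<forall>t\<ge>0. real_distribution (\<mu> t)) \<and>
     (\<forall>f :: real \<Rightarrow> real. continuous_on UNIV f \<and> bounded (range f) \<longrightarrow>
        continuous_on {0..} (\<lambda>t. \<integral>x. f x \<partial>\<mu> t)) \<and>
     (\<forall>(f :: real \<Rightarrow> real) f'.
        (\<forall>x. (f has_real_derivative f' x) (at x)) \<and> continuous_on UNIV f' \<and>
        bounded (range f) \<and> bounded (range f') \<longrightarrow>
        (\<forall>t>0. (\<integral>x. f x \<partial>\<mu> t) - (\<integral>x. f x \<partial>\<mu> 0) =
          (LINT s:{0..t}|lborel.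
             - (\<integral>x. f' x * indicator {0<..} x + f x \<partial>\<mu> s)
             + (\<integral>z. f (fst z + snd z) \<partial>(\<mu> s \<Otimes>\<^sub>M \<mu> s)))))"

text \<open>
  The limit is taken in the extended half-line, so that a non-integrable law would contribute
  \<open>\<infinity>\<close> and not \<open>0\<close>.
\<close>

definition free_energy :: "(real \<Rightarrow> real measure) \<Rightarrow> ennreal" where
  "free_energy \<mu> =
     Lim at_top (\<lambda>t. ennreal (exp (- t)) * (\<integral>\<^sup>+x\<in>{0..}. ennreal x \<partial>\<mu> t))"

text \<open>
  The law \<open>p \<delta>\<^sub>0 + (1 - p) \<lambda> exp (- \<lambda> x) 1\<^sub>{\<^sub>x\<^sub>>\<^sub>0\<^sub>} dx\<close>.
\<close>

definition init_law :: "real \<Rightarrow> real \<Rightarrow> real measure" where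
  "init_law p l = measure_of UNIV (sets borel)
     (\<lambda>A. ennreal p * emeasure (return borel 0) A
        + ennreal (1 - p) * emeasure (density lborel (\<lambda>x. ennreal (l * exp (- l * x)) * indicator {0<..} x)) A)"

lemma sets_init_law [simp]: "sets (init_law p l) = sets borel"
  and space_init_law [simp]: "space (init_law p l) = UNIV"
  by (simp_all add: init_law_def sets_measure_of_conv space_measure_of_conv sets.sigma_sets_eq[of borel, simplified])

lemma emeasure_init_law:
  assumes "A \<in> sets borel"
  shows "emeasure (init_law p l) A =
    ennreal p * indicator A 0
    + ennreal (1 - p) * (\<integral>\<^sup>+x\<in>A. ennreal (l * exp (- l * x)) * indicator {0<..} x \<partial>lborel)"
proof -
  let ?N = "density lborel (\<lambda>x. ennreal (l * exp (- l * x)) * indicator {0<..} x)"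
  let ?m = "\<lambda>A. ennreal p * emeasure (return borel 0) A + ennreal (1 - p) * emeasure ?N A"
  have sa: "sigma_algebra (UNIV :: real set) (sets borel)"
    using sets.sigma_algebra_axioms[of "borel :: real measure"] by simp
  have pos: "positive (sets borel) ?m"
    by (simp add: positive_def)
  have ca: "countably_additive (sets borel) ?m"
  proof (rule countably_additiveI)
    fix B :: "nat \<Rightarrow> real set"
    assume B: "range B \<subseteq> sets borel" "disjoint_family B"
    have "(\<Sum>i. ?m (B i)) =
        ennreal p * (\<Sum>i. emeasure (return borel 0) (B i)) + ennreal (1 - p) * (\<Sum>i. emeasure ?N (B i))"
      by (subst suminf_add[symmetric]) (auto simp: ennreal_suminf_cmult)
    also have "(\<Sum>i. emeasure (return borel 0) (B i)) = emeasure (return borel 0) (\<Union>i. B i)"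
      using B by (intro suminf_emeasure) auto
    also have "(\<Sum>i. emeasure ?N (B i)) = emeasure ?N (\<Union>i. B i)"
      using B by (intro suminf_emeasure) auto
    finally show "(\<Sum>i. ?m (B i)) = ?m (\<Union>(range B))" .
  qed
  have "emeasure (init_law p l) A = ?m A"
    unfolding init_law_def by (rule emeasure_measure_of_sigma[OF sa pos ca assms])
  then show ?thesis
    using assms by (simp add: emeasure_density)
qed

end

theory Submission
  imports Defs "HOL-Real_Asymp.Real_Asymp"
begin

text \<open>
  Mixed exponential laws are preserved by the flow: if \<open>P' = (1 - P) (L - P)\<close> and
  \<open>L' = - (1 - P) L\<close>, then the laws \<open>P \<delta>\<^sub>0 + (1 - P) L exp (- L x) dx\<close> solve the equation.  Any
  model with the same initial law agrees with this one: on test functions that are constant on the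
  negative half-line the drift is a translation, so the tails \<open>G\<^sub>s(z) = \<mu>\<^sub>s((z, \<infinity>))\<close> satisfy, for
  \<open>z \<ge> 0\<close>, the mild equation
  \<open>G\<^sub>t(z) - G\<^sub>0(z + t) = \<integral>\<^sub>0\<^sup>t ((\<mu>\<^sub>s * \<mu>\<^sub>s)((z + t - s, \<infinity>)) - G\<^sub>s(z + t - s)) ds\<close>,
  and the Kolmogorov distance of two solutions obeys a Gronwall inequality.

  With \<open>L = l exp (- x)\<close> and \<open>D(x) = exp x - p - l x\<close> the system becomes \<open>x' = exp (- x) D(x)\<close>, and
  \<open>F = (1 - p) / l * exp (- l \<integral>\<^sub>0\<^sup>\<infinity> dx / D(x))\<close>.  As \<open>p\<close> tends to its critical value, \<open>D\<close>
  degenerates at \<open>x = max 0 (ln l)\<close>: quadratically and in the interior if \<open>l > 1\<close>, quadratically at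
  the end point if \<open>l = 1\<close>, and linearly at the end point if \<open>l < 1\<close>.
\<close>

subsection \<open>Convolutions and weak continuity\<close>

text \<open>Test functions constant on the positive half-line are used as well: the drift does not
  act on them, and they show that no mass ever appears on the negative half-line. Tails at negative
  levels are thus known, as the convolution term requires. The mixed exponential laws are checked
  against the mild equation only; this is what the comparison with a given model uses. In the clock
  \<open>x = \<integral> (1 - P) dt\<close> the system reads \<open>dL/dx = - L\<close>,
  \<open>dP/dx = L - P\<close>, hence \<open>P exp x = p + l x\<close>. The time needed to reach
  \<open>x\<close> is the integral of \<open>exp y / D(y)\<close>. Writing
  \<open>exp y = D'(y) + l\<close> turns this into
  \<open>exp (- t) = (1 - p) / D(x) * exp (- l \<integral> dy / D(y))\<close>. Since the law at that
  time has mean \<open>D(x) / l\<close>, the factor \<open>D(x)\<close> cancels. The minimum of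
  \<open>exp x - l x\<close> is attained at \<open>ln l\<close> and equals
  \<open>l - l ln l\<close>, the critical value for \<open>l \<ge> 1\<close>. Near it, with
  \<open>w = x - ln l\<close> and \<open>e = (p_c - p) / l\<close>, one has
  \<open>D = l (e + w^2 / 2 + w^3 / 6 + ...)\<close>.\<close>

definition add_law :: "real measure \<Rightarrow> real measure \<Rightarrow> real measure" where
  "add_law M N = distr (M \<Otimes>\<^sub>M N) borel (\<lambda>z. fst z + snd z)"

lemma real_distribution_pairD:
  assumes "real_distribution M" "real_distribution N"
  shows "pair_prob_space M N" "sets (M \<Otimes>\<^sub>M N) = sets (borel \<Otimes>\<^sub>M borel)"
proof -
  interpret M: real_distribution M by fact
  interpret N: real_distribution N by fact
  show "pair_prob_space M N" by unfold_locales
  show "sets (M \<Otimes>\<^sub>M N) = sets (borel \<Otimes>\<^sub>M borel)"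
    by (intro sets_pair_measure_cong) auto
qed

lemma measurable_add_pair:
  assumes "real_distribution M" "real_distribution N"
  shows "(\<lambda>z. fst z + snd z) \<in> borel_measurable (M \<Otimes>\<^sub>M N)"
proof -
  have "(\<lambda>z::real \<times> real. fst z + snd z) \<in> borel_measurable (borel \<Otimes>\<^sub>M borel)" by measurable
  then show ?thesis
    using measurable_cong_sets[OF real_distribution_pairD(2)[OF assms] refl, of borel] by blast
qed

lemma real_distribution_add_law:
  assumes "real_distribution M" "real_distribution N"
  shows "real_distribution (add_law M N)"
proof -
  interpret pair_prob_space M N using real_distribution_pairD[OF assms] by simp
  show ?thesis unfolding add_law_def
    by (rule real_distribution_distr) (rule measurable_add_pair[OF assms])
qed

lemma integral_add_law:
  fixes f :: "real \<Rightarrow> real"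
  assumes "real_distribution M" "real_distribution N" "f \<in> borel_measurable borel"
  shows "(\<integral>x. f x \<partial>add_law M N) = (\<integral>z. f (fst z + snd z) \<partial>(M \<Otimes>\<^sub>M N))"
  unfolding add_law_def by (rule integral_distr[OF measurable_add_pair[OF assms(1,2)] assms(3)])

lemma char_add_law:
  assumes "real_distribution M" "real_distribution N"
  shows "char (add_law M N) t = char M t * char N t"
proof -
  interpret M: real_distribution M by fact
  interpret N: real_distribution N by fact
  interpret P: pair_prob_space M N using real_distribution_pairD[OF assms] by simp
  have "(\<lambda>z. iexp (t * (fst z + snd z))) \<in> borel_measurable (M \<Otimes>\<^sub>M N)"
    using measurable_add_pair[OF assms] by measurable
  then have int: "integrable (M \<Otimes>\<^sub>M N) (\<lambda>z. iexp (t * (fst z + snd z)))"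
    by (intro P.integrable_const_bound[where B=1]) auto
  have "char (add_law M N) t = (\<integral>z. iexp (t * (fst z + snd z)) \<partial>(M \<Otimes>\<^sub>M N))"
    unfolding char_def add_law_def by (rule integral_distr[OF measurable_add_pair[OF assms]]) simp
  also have "\<dots> = (\<integral>x. (\<integral>y. iexp (t * x) * iexp (t * y) \<partial>N) \<partial>M)"
    using P.integral_fst'[OF int] by (simp add: distrib_left exp_add)
  also have "\<dots> = (\<integral>x. iexp (t * x) * char N t \<partial>M)" unfolding char_def by simp
  also have "\<dots> = char M t * char N t" unfolding char_def by simp
  finally show ?thesis .
qed

locale DR =
  fixes \<mu>0 and \<mu> :: "real \<Rightarrow> real measure"
  assumes DR: "DR_model \<mu>0 \<mu>"
begin

lemma rd: "0 \<le> t \<Longrightarrow> real_distribution (\<mu> t)"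
  using DR by (auto simp: DR_model_def)

lemma cont_integral:
  fixes f :: "real \<Rightarrow> real"
  assumes "continuous_on UNIV f" "\<And>x. \<bar>f x\<bar> \<le> B"
  shows "continuous_on {0..} (\<lambda>t. \<integral>x. f x \<partial>\<mu> t)"
proof -
  have "bounded (range f)" using assms(2) by (auto simp: bounded_iff)
  then show ?thesis using DR assms(1) by (auto simp: DR_model_def)
qed

lemma cont_char: "continuous_on {0..} (\<lambda>t. char (\<mu> t) u)"
proof -
  have *: "char (\<mu> t) u = complex_of_real (\<integral>x. cos (u * x) \<partial>\<mu> t) + \<i> * complex_of_real (\<integral>x. sin (u * x) \<partial>\<mu> t)"
    if "t \<ge> 0" for t
  proof -
    interpret real_distribution "\<mu> t" using rd that by simp
    have i: "integrable (\<mu> t) (\<lambda>x. cos (u * x))" "integrable (\<mu> t) (\<lambda>x. sin (u * x))"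
      by (auto intro!: integrable_const_bound[where B=1])
    have "iexp (u * x) = complex_of_real (cos (u * x)) + \<i> * complex_of_real (sin (u * x))" for x
      by (simp add: cis_conv_exp[symmetric] complex_eq_iff del: of_real_mult)
    then have "char (\<mu> t) u = (\<integral>x. complex_of_real (cos (u * x)) + \<i> * complex_of_real (sin (u * x)) \<partial>\<mu> t)"
      unfolding char_def by presburger
    also have "\<dots> = (\<integral>x. complex_of_real (cos (u * x)) \<partial>\<mu> t) + (\<integral>x. \<i> * complex_of_real (sin (u * x)) \<partial>\<mu> t)"
      using i by (intro Bochner_Integration.integral_add integrable_mult_right integrable_of_real)
    finally show ?thesis by simp
  qed
  have "continuous_on {0..} (\<lambda>t. complex_of_real (\<integral>x. cos (u * x) \<partial>\<mu> t) + \<i> * complex_of_real (\<integral>x. sin (u * x) \<partial>\<mu> t))"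
    by (intro continuous_intros cont_integral[where B=1]) auto
  then show ?thesis by (rule continuous_on_eq) (simp add: *)
qed

text \<open>Weak continuity is given for \<open>\<mu>\<close> alone. The characteristic function of
  the convolution square is the square of a function continuous in time, and Levy's continuity
  theorem turns this back into weak continuity.\<close>

lemma cont_integral_add_law:
  fixes f :: "real \<Rightarrow> real"
  assumes f: "continuous_on UNIV f" "\<And>x. \<bar>f x\<bar> \<le> B"
  shows "continuous_on {0..} (\<lambda>t. \<integral>x. f x \<partial>add_law (\<mu> t) (\<mu> t))"
  unfolding continuous_on_sequentially
proof safe
  fix X :: "nat \<Rightarrow> real" and a assume X: "\<forall>n. X n \<in> {0..}" "X \<longlonglongrightarrow> a" and a: "0 \<le> a"
  have "\<And>u. (\<lambda>n. char (\<mu> (X n)) u) \<longlonglongrightarrow> char (\<mu> a) u"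
    using cont_char X a unfolding continuous_on_sequentially by (auto simp: o_def)
  then have "(\<lambda>n. char (add_law (\<mu> (X n)) (\<mu> (X n))) u) \<longlonglongrightarrow> char (add_law (\<mu> a) (\<mu> a)) u" for u
    using X a rd by (simp add: char_add_law tendsto_mult)
  then have w: "weak_conv_m (\<lambda>n. add_law (\<mu> (X n)) (\<mu> (X n))) (add_law (\<mu> a) (\<mu> a))"
    using X a rd by (intro levy_continuity real_distribution_add_law) auto
  have "(\<lambda>n. \<integral>x. f x \<partial>add_law (\<mu> (X n)) (\<mu> (X n))) \<longlonglongrightarrow> (\<integral>x. f x \<partial>add_law (\<mu> a) (\<mu> a))"
    using X a rd f w
    by (intro weak_conv_imp_integral_bdd_continuous_conv[where B=B] real_distribution_add_law)
       (auto simp: continuous_on_eq_continuous_at)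
  then show "((\<lambda>t. \<integral>x. f x \<partial>add_law (\<mu> t) (\<mu> t)) \<circ> X) \<longlonglongrightarrow> (\<integral>x. f x \<partial>add_law (\<mu> a) (\<mu> a))"
    by (simp add: o_def)
qed

text \<open>The function \<open>g\<close> stands for \<open>f'\<close> cut off by the indicator. Its
  continuity makes the integrand continuous in \<open>s\<close>, so the equation can later be
  differentiated in time. Two cases occur: \<open>g = f'\<close> when \<open>f'\<close> vanishes on
  the negative half-line, and \<open>g = 0\<close> when \<open>f'\<close> vanishes on the positive
  one.\<close>

lemma weak_equation:
  fixes f f' :: "real \<Rightarrow> real"
  assumes f: "\<And>x. (f has_real_derivative f' x) (at x)" "continuous_on UNIV f'"
      "\<And>x. \<bar>f x\<bar> \<le> B" "\<And>x. \<bar>f' x\<bar> \<le> B'"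
    and g: "\<And>x. f' x * indicator {0<..} x = g x" "continuous_on UNIV g"
    and t: "0 \<le> t"
  shows "(\<integral>x. f x \<partial>\<mu> t) - (\<integral>x. f x \<partial>\<mu> 0) =
    integral {0..t} (\<lambda>s. - (\<integral>x. g x \<partial>\<mu> s) - (\<integral>x. f x \<partial>\<mu> s) + (\<integral>x. f x \<partial>add_law (\<mu> s) (\<mu> s)))"
    (is "_ = integral _ ?A")
    and "continuous_on {0..} (\<lambda>s. - (\<integral>x. g x \<partial>\<mu> s) - (\<integral>x. f x \<partial>\<mu> s) + (\<integral>x. f x \<partial>add_law (\<mu> s) (\<mu> s)))"
proof -
  have fc: "continuous_on UNIV f"
    using f(1) by (meson DERIV_isCont continuous_at_imp_continuous_on)
  have B': "0 \<le> B'" using f(4)[of 0] by linarith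
  have gB: "\<bar>g x\<bar> \<le> B'" for x
    using f(4)[of x] B' unfolding g(1)[symmetric] by (auto simp: indicator_def)
  show c: "continuous_on {0..} ?A"
    using f fc g gB by (intro continuous_intros cont_integral[where B=B] cont_integral[where B=B'] cont_integral_add_law[where B=B]) auto
  show "(\<integral>x. f x \<partial>\<mu> t) - (\<integral>x. f x \<partial>\<mu> 0) = integral {0..t} ?A"
  proof (cases "t = 0")
    case False
    have bd: "bounded (range f)" "bounded (range f')"
      using f(3,4) by (auto simp: bounded_iff)
    have "(\<integral>x. f x \<partial>\<mu> t) - (\<integral>x. f x \<partial>\<mu> 0) =
          (LINT s:{0..t}|lborel.
             - (\<integral>x. f' x * indicator {0<..} x + f x \<partial>\<mu> s)
             + (\<integral>z. f (fst z + snd z) \<partial>(\<mu> s \<Otimes>\<^sub>M \<mu> s)))"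
      using DR[unfolded DR_model_def, THEN conjunct2, THEN conjunct2, THEN conjunct2, THEN conjunct2,
          THEN conjunct2, rule_format, of f f' t] f(1,2) bd t False by simp
    also have "\<dots> = (LINT s:{0..t}|lborel. ?A s)"
    proof (rule set_lebesgue_integral_cong)
      show "\<forall>s. s \<in> {0..t} \<longrightarrow> - (\<integral>x. f' x * indicator {0<..} x + f x \<partial>\<mu> s)
             + (\<integral>z. f (fst z + snd z) \<partial>(\<mu> s \<Otimes>\<^sub>M \<mu> s)) = ?A s"
      proof safe
        fix s assume s: "s \<in> {0..t}"
        then interpret real_distribution "\<mu> s" using rd by simp
        have [measurable]: "f \<in> borel_measurable borel" "g \<in> borel_measurable borel"
          using fc g(2) by (auto intro: borel_measurable_continuous_onI)
        have "integrable (\<mu> s) f" "integrable (\<mu> s) g"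
          using integrable_const_bound[of f B] integrable_const_bound[of g B'] f(3) gB by auto
        then show "- (\<integral>x. f' x * indicator {0<..} x + f x \<partial>\<mu> s)
             + (\<integral>z. f (fst z + snd z) \<partial>(\<mu> s \<Otimes>\<^sub>M \<mu> s)) = ?A s"
          using integral_add_law[of "\<mu> s" "\<mu> s" f] real_distribution_axioms by (simp add: g(1))
      qed
    qed simp
    also have "\<dots> = integral {0..t} ?A"
      using c by (intro set_borel_integral_eq_integral borel_integrable_atLeastAtMost' )
         (auto intro: continuous_on_subset)
    finally show ?thesis .
  qed simp
qed

end

subsection \<open>Smoothed indicator functions\<close>

text \<open>Equal to \<open>u / (1 + u)\<close> with \<open>u = (max 0 x)^2\<close>: a rational
  profile that is continuously differentiable, vanishes together with its derivative for
  \<open>x \<le> 0\<close>, and increases to 1. Rescaled by a large factor it approximates the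
  indicator of an open half-line.\<close>

definition sstep :: "real \<Rightarrow> real" where
  "sstep x = 1 - 1 / (1 + (max 0 x)\<^sup>2)"

definition sstep' :: "real \<Rightarrow> real" where
  "sstep' x = 2 * max 0 x / (1 + (max 0 x)\<^sup>2)\<^sup>2"

text \<open>A second-order error bound is convenient in two places: at the kink of
  \<open>max 0 x\<close>, where it is checked by cases, and under an integral, where a uniform bound
  can simply be integrated.\<close>

lemma has_real_derivative_quadratic_bound:
  fixes g :: "real \<Rightarrow> real"
  assumes "\<And>y. \<bar>g y - g x - D * (y - x)\<bar> \<le> C * (y - x)\<^sup>2"
  shows "(g has_real_derivative D) (at x within S)"
proof -
  have "((\<lambda>y. (g y - g x) / (y - x) - D) \<longlongrightarrow> 0) (at x)"
  proof (rule Lim_null_comparison)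
    have "norm ((g y - g x) / (y - x) - D) \<le> C * \<bar>y - x\<bar>" if "y \<noteq> x" for y
    proof -
      have "\<bar>(g y - g x) / (y - x) - D\<bar> = \<bar>g y - g x - D * (y - x)\<bar> / \<bar>y - x\<bar>"
        using that by (simp add: abs_divide[symmetric] diff_divide_distrib)
      also have "\<dots> \<le> C * (y - x)\<^sup>2 / \<bar>y - x\<bar>" using assms by (intro divide_right_mono) auto
      also have "\<dots> = C * \<bar>y - x\<bar>"
        using that by (simp add: divide_simps power2_eq_square)
      finally show ?thesis by simp
    qed
    then show "\<forall>\<^sub>F y in at x. norm ((g y - g x) / (y - x) - D) \<le> C * \<bar>y - x\<bar>"
      by (auto simp: eventually_at_filter)
    have "((\<lambda>y. C * \<bar>y - x\<bar>) \<longlongrightarrow> C * \<bar>x - x\<bar>) (at x)" by (intro tendsto_intros)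
    then show "((\<lambda>y. C * \<bar>y - x\<bar>) \<longlongrightarrow> 0) (at x)" by simp
  qed
  then have "(g has_real_derivative D) (at x)"
    by (simp add: has_field_derivative_iff LIM_zero_iff)
  then show ?thesis by (rule DERIV_subset) simp
qed

lemma max0_square_deriv: "((\<lambda>x::real. (max 0 x)\<^sup>2) has_real_derivative 2 * max 0 x) (at x)"
proof (rule has_real_derivative_quadratic_bound[where C=1])
  fix y :: real
  have A: "x * y \<le> 0" if "x > 0" "y \<le> 0" using that by (simp add: mult_nonneg_nonpos)
  have B: "y\<^sup>2 \<le> (y - x)\<^sup>2" if "y > 0" "x \<le> 0" using that by (intro power_mono) auto
  consider "x > 0" "y > 0" | "x > 0" "y \<le> 0" | "x \<le> 0" "y > 0" | "x \<le> 0" "y \<le> 0" by linarith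
  then show "\<bar>(max 0 y)\<^sup>2 - (max 0 x)\<^sup>2 - 2 * max 0 x * (y - x)\<bar> \<le> 1 * (y - x)\<^sup>2"
  proof cases
    case 1
    have "(max 0 y)\<^sup>2 - (max 0 x)\<^sup>2 - 2 * max 0 x * (y - x) = (y - x)\<^sup>2"
      using 1 by (simp add: power2_eq_square algebra_simps)
    then show ?thesis by simp
  next
    case 2
    then have "(max 0 y)\<^sup>2 - (max 0 x)\<^sup>2 - 2 * max 0 x * (y - x) = x\<^sup>2 - 2 * (x * y)"
      by (simp add: power2_eq_square algebra_simps)
    moreover have "(y - x)\<^sup>2 = x\<^sup>2 - 2 * (x * y) + y\<^sup>2" by (simp add: power2_eq_square algebra_simps)
    ultimately show ?thesis using A[OF 2] zero_le_power2[of x] zero_le_power2[of y]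
      by (simp only: abs_le_iff mult_1) linarith
  qed (use B in auto)
qed

lemma one_plus_sq_pos: "0 < 1 + (y::real)\<^sup>2"
  by (rule add_pos_nonneg) auto

lemma sstep_deriv: "(sstep has_real_derivative sstep' x) (at x)"
proof -
  have "1 + (max 0 x)\<^sup>2 \<noteq> 0" using one_plus_sq_pos[of "max 0 x"] by linarith
  then have "((\<lambda>x. 1 - 1 / (1 + (max 0 x)\<^sup>2)) has_real_derivative
      0 - (0 * (1 + (max 0 x)\<^sup>2) - 1 * (0 + 2 * max 0 x)) / ((1 + (max 0 x)\<^sup>2) * (1 + (max 0 x)\<^sup>2))) (at x)"
    by (intro DERIV_diff DERIV_const DERIV_divide DERIV_add max0_square_deriv)
  then show ?thesis unfolding sstep_def[abs_def] sstep'_def by (simp add: power2_eq_square)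
qed

lemma sstep_bounds: "0 \<le> sstep x" "sstep x \<le> 1" "\<bar>sstep x\<bar> \<le> 1"
  using one_plus_sq_pos[of "max 0 x"] by (auto simp: sstep_def divide_simps)

lemma sstep_nonpos: "x \<le> 0 \<Longrightarrow> sstep x = 0" "x \<le> 0 \<Longrightarrow> sstep' x = 0"
  by (auto simp: sstep_def sstep'_def)

lemma sstep_pos: "0 < x \<Longrightarrow> 0 < sstep x"
  using one_plus_sq_pos[of x] by (auto simp: sstep_def)

lemma sstep'_bound: "\<bar>sstep' x\<bar> \<le> 2"
proof -
  define y where "y = max 0 x"
  have "y \<ge> 0" by (simp add: y_def)
  have "2 * y \<le> 1 + y\<^sup>2" using sum_squares_bound[of y 1] by simp
  also have "\<dots> \<le> (1 + y\<^sup>2)\<^sup>2" by (rule self_le_power) auto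
  finally have "2 * y \<le> 2 * (1 + y\<^sup>2)\<^sup>2" using \<open>0 \<le> y\<close> by simp
  then show ?thesis using one_plus_sq_pos[of y] \<open>0 \<le> y\<close>
    by (simp add: sstep'_def y_def[symmetric] divide_simps)
qed

text \<open>The kink is avoided by composing the smooth function \<open>2 u / (1 + u^2)^2\<close>,
  whose derivative is bounded by 6, with the 1-Lipschitz map \<open>max 0\<close>.\<close>

lemma sstep'_Lipschitz: "\<bar>sstep' x - sstep' y\<bar> \<le> 6 * \<bar>x - y\<bar>"
proof -
  let ?k = "\<lambda>u::real. 2 * u / (1 + u\<^sup>2)\<^sup>2" and ?k' = "\<lambda>u::real. (2 - 6 * u\<^sup>2) / (1 + u\<^sup>2) ^ 3"
  have "norm (?k (max 0 x) - ?k (max 0 y)) \<le> 6 * norm (max 0 x - max 0 y)"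
  proof (rule field_differentiable_bound[of UNIV ?k ?k'])
    fix u :: real
    have p: "1 + u\<^sup>2 > 0" by (rule one_plus_sq_pos)
    then have nz: "1 + u\<^sup>2 \<noteq> 0" by simp
    have "(?k has_field_derivative
       (2 * (1 + u\<^sup>2)\<^sup>2 - (2 * u) * (2 * (1 + u\<^sup>2) * (2 * u))) / ((1 + u\<^sup>2)\<^sup>2 * (1 + u\<^sup>2)\<^sup>2)) (at u)"
      using nz by (auto intro!: derivative_eq_intros)
    moreover have "(2 * (1 + u\<^sup>2)\<^sup>2 - (2 * u) * (2 * (1 + u\<^sup>2) * (2 * u))) / ((1 + u\<^sup>2)\<^sup>2 * (1 + u\<^sup>2)\<^sup>2) = ?k' u"
    proof -
      have "2 * (1 + u\<^sup>2)\<^sup>2 - (2 * u) * (2 * (1 + u\<^sup>2) * (2 * u)) = (1 + u\<^sup>2) * (2 - 6 * u\<^sup>2)"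
        by (simp add: power2_eq_square algebra_simps)
      moreover have "(1 + u\<^sup>2)\<^sup>2 * (1 + u\<^sup>2)\<^sup>2 = (1 + u\<^sup>2) * (1 + u\<^sup>2) ^ 3"
        by (simp only: power2_eq_square power3_eq_cube mult.assoc)
      ultimately show ?thesis using nz by simp
    qed
    ultimately show "(?k has_field_derivative ?k' u) (at u within UNIV)" by simp
    have "\<bar>2 - 6 * u\<^sup>2\<bar> \<le> 6 * (1 + u\<^sup>2)" by (simp add: abs_le_iff)
    also have "\<dots> \<le> 6 * (1 + u\<^sup>2) ^ 3" by (intro mult_left_mono self_le_power) auto
    finally show "norm (?k' u) \<le> 6" using p by (simp add: divide_simps)
  qed auto
  also have "\<dots> \<le> 6 * \<bar>x - y\<bar>" by auto
  finally show ?thesis by (simp add: sstep'_def)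
qed

lemma sstep'_continuous: "continuous_on UNIV sstep'"
  unfolding sstep'_def[abs_def]
  by (intro continuous_intros) (use one_plus_sq_pos in \<open>auto simp: less_imp_neq[symmetric]\<close>)

text \<open>The error is uniform in the base point, so it survives integration against any law; this
  gives differentiability of smoothed tails in the level.\<close>

lemma sstep_linearization: "\<bar>sstep b - sstep a - sstep' a * (b - a)\<bar> \<le> 6 * (b - a)\<^sup>2"
proof (cases "a = b")
  case False
  have "\<exists>\<xi>. \<bar>\<xi> - a\<bar> \<le> \<bar>b - a\<bar> \<and> sstep b - sstep a = (b - a) * sstep' \<xi>"
  proof (cases "a < b")
    case True
    obtain z where "a < z" "z < b" "sstep b - sstep a = (b - a) * sstep' z"
      using MVT2[of a b sstep sstep'] True sstep_deriv by auto
    then show ?thesis by (intro exI[of _ z]) auto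
  next
    case nl: False
    obtain z where "b < z" "z < a" "sstep a - sstep b = (a - b) * sstep' z"
      using MVT2[of b a sstep sstep'] nl False sstep_deriv by auto
    then show ?thesis by (intro exI[of _ z]) (auto simp: algebra_simps)
  qed
  then obtain \<xi> where xi: "\<bar>\<xi> - a\<bar> \<le> \<bar>b - a\<bar>" "sstep b - sstep a = (b - a) * sstep' \<xi>" by blast
  have "\<bar>sstep b - sstep a - sstep' a * (b - a)\<bar> = \<bar>b - a\<bar> * \<bar>sstep' \<xi> - sstep' a\<bar>"
    by (simp add: xi(2) abs_mult[symmetric] algebra_simps)
  also have "\<dots> \<le> \<bar>b - a\<bar> * (6 * \<bar>b - a\<bar>)"
    using sstep'_Lipschitz[of \<xi> a] xi(1) by (intro mult_left_mono) auto
  also have "\<dots> = 6 * (b - a)\<^sup>2" by (simp add: power2_eq_square)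
  finally show ?thesis .
qed simp

text \<open>The map \<open>u / (1 + u)\<close> is increasing, and \<open>u\<close> at
  \<open>x + y\<close> is at most twice the sum of the values of \<open>u\<close> at
  \<open>x\<close> and \<open>y\<close>. The inequality bounds the convolution term linearly when
  the mass on the negative half-line is estimated.\<close>

lemma sstep_sublinear: "sstep (x + y) \<le> 2 * (sstep x + sstep y)"
proof -
  define a b c where "a = (max 0 x)\<^sup>2" and "b = (max 0 y)\<^sup>2" and "c = (max 0 (x + y))\<^sup>2"
  have nn: "a \<ge> 0" "b \<ge> 0" "c \<ge> 0" by (auto simp: a_def b_def c_def)
  have "c \<le> (max 0 x + max 0 y)\<^sup>2" unfolding c_def by (intro power_mono) auto
  also have "\<dots> \<le> 2 * a + 2 * b" using sum_squares_bound[of "max 0 x" "max 0 y"]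
    by (simp add: a_def b_def power2_sum)
  finally have c: "c \<le> 2 * a + 2 * b" .
  have mono: "u / (1 + u) \<le> v / (1 + v)" if "0 \<le> u" "u \<le> v" for u v :: real
  proof -
    have "1 / (1 + v) \<le> 1 / (1 + u)" using that by (intro divide_left_mono mult_pos_pos) auto
    moreover have "u / (1 + u) = 1 - 1 / (1 + u)" "v / (1 + v) = 1 - 1 / (1 + v)"
      using that by (simp_all add: divide_simps)
    ultimately show ?thesis by linarith
  qed
  have "c / (1 + c) \<le> (2 * a + 2 * b) / (1 + (2 * a + 2 * b))"
    by (rule mono) (use c nn in auto)
  also have "\<dots> = 2 * a / (1 + (2 * a + 2 * b)) + 2 * b / (1 + (2 * a + 2 * b))"
    by (rule add_divide_distrib)
  also have "\<dots> \<le> 2 * a / (1 + a) + 2 * b / (1 + b)"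
    using nn by (intro add_mono divide_left_mono) auto
  finally have "c / (1 + c) \<le> 2 * (a / (1 + a) + b / (1 + b))" by simp
  moreover have "sstep x = a / (1 + a)" "sstep y = b / (1 + b)" "sstep (x + y) = c / (1 + c)"
    using nn by (simp_all add: sstep_def a_def[symmetric] b_def[symmetric] c_def[symmetric] divide_simps)
  ultimately show ?thesis by simp
qed

lemma sstep_measurable [measurable]: "sstep \<in> borel_measurable borel" "sstep' \<in> borel_measurable borel"
  using sstep_deriv sstep'_continuous
  by (auto intro!: borel_measurable_continuous_onI continuous_at_imp_continuous_on intro: DERIV_isCont)

text \<open>The limit is the indicator of the open half-line because \<open>sstep\<close> vanishes
  at 0; tails are therefore taken with strict inequality.\<close>

lemma sstep_limit: "(\<lambda>n. sstep (real (Suc n) * (x - w))) \<longlonglongrightarrow> indicator {w<..} x"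
proof (cases "w < x")
  case True
  have *: "filterlim (\<lambda>n. 1 + (real (Suc n) * (x - w))\<^sup>2) at_top sequentially"
    using True by real_asymp
  have "(\<lambda>n. 1 - 1 / (1 + (real (Suc n) * (x - w))\<^sup>2)) \<longlonglongrightarrow> 1 - 0"
    by (intro tendsto_diff tendsto_const tendsto_divide_0[OF tendsto_const] filterlim_at_top_imp_at_infinity *)
  moreover have "sstep (real (Suc n) * (x - w)) = 1 - 1 / (1 + (real (Suc n) * (x - w))\<^sup>2)" for n
    using True by (simp add: sstep_def max_def zero_less_mult_iff)
  ultimately show ?thesis using True by simp
next
  case False
  then show ?thesis by (simp add: sstep_nonpos mult_nonneg_nonpos)
qed

subsection \<open>Gronwall iteration\<close>

text \<open>Iterating the step from the bound 1 gives \<open>C^k t^k / k!\<close>, which tends to 0.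
  The index \<open>i\<close> will be the level of a tail. Passing bounds for all indices at once
  from one step to the next avoids the supremum over \<open>i\<close> as a function of time, and
  with it any question of its measurability.\<close>

lemma gronwall_iteration:
  fixes d :: "'i \<Rightarrow> real \<Rightarrow> real"
  assumes bound: "\<And>i t. 0 \<le> t \<Longrightarrow> \<bar>d i t\<bar> \<le> 1" and C: "0 \<le> C"
    and step: "\<And>i t M k. 0 \<le> t \<Longrightarrow> 0 \<le> M \<Longrightarrow> (\<And>j s. 0 \<le> s \<Longrightarrow> \<bar>d j s\<bar> \<le> M * s ^ k) \<Longrightarrow>
       \<bar>d i t\<bar> \<le> C * (M * t ^ Suc k / Suc k)"
    and t: "0 \<le> t"
  shows "d i t = 0"
proof -
  have "\<forall>i t. 0 \<le> t \<longrightarrow> \<bar>d i t\<bar> \<le> C ^ k / fact k * t ^ k" for k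
  proof (induction k)
    case 0
    then show ?case using bound by simp
  next
    case (Suc k)
    show ?case
    proof safe
      fix i and t :: real assume t: "0 \<le> t"
      have "\<bar>d i t\<bar> \<le> C * (C ^ k / fact k * t ^ Suc k / Suc k)"
        using t Suc C by (intro step) auto
      also have "\<dots> = C ^ Suc k / fact (Suc k) * t ^ Suc k"
        by (simp add: divide_simps)
      finally show "\<bar>d i t\<bar> \<le> C ^ Suc k / fact (Suc k) * t ^ Suc k" .
    qed
  qed
  then have "\<bar>d i t\<bar> \<le> (C * t) ^ k / fact k" for k
    using t by (auto simp: power_mult_distrib)
  moreover have "(\<lambda>k. (C * t) ^ k / fact k) \<longlonglongrightarrow> 0"
    using summable_LIMSEQ_zero[OF summable_exp_generic[of "C * t"]] by (simp add: field_simps)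
  ultimately have "\<bar>d i t\<bar> \<le> 0" by (intro LIMSEQ_le_const[of "\<lambda>k. (C * t) ^ k / fact k"]) auto
  then show ?thesis by simp
qed

lemma has_integral_power_bound:
  fixes f :: "real \<Rightarrow> real"
  assumes f: "(f has_integral I) {0..t}" and t: "0 \<le> t"
    and le: "\<And>s. s \<in> {0..t} \<Longrightarrow> f s \<le> C * (M * s ^ k)"
  shows "I \<le> C * (M * t ^ Suc k / Suc k)"
proof -
  have "((\<lambda>s. s ^ k) has_integral (t ^ Suc k / Suc k - 0 ^ Suc k / Suc k)) {0..t}"
    using t by (intro fundamental_theorem_of_calculus)
       (auto intro!: derivative_eq_intros simp: has_real_derivative_iff_has_vector_derivative[symmetric] simp del: power_Suc)
  then have "((\<lambda>s. C * (M * s ^ k)) has_integral C * (M * (t ^ Suc k / Suc k))) {0..t}"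
    by (intro has_integral_mult_right) simp
  from has_integral_le[OF f this le] show ?thesis by simp
qed

subsection \<open>Positivity of the support and the mild equation\<close>

context DR begin

text \<open>The functional \<open>b\<close> below detects mass on the negative half-line. The drift
  does not act on its test function, and a sum is negative only if some summand is, so the
  convolution produces at most a multiple of \<open>b\<close> itself. As \<open>b\<close> starts
  from 0, it stays there.\<close>

lemma AE_nonneg:
  assumes t: "0 \<le> t"
  shows "AE x in \<mu> t. 0 \<le> x"
proof -
  let ?f = "\<lambda>x. sstep (- x)"
  \<comment> \<open>The dummy index of type \<open>unit\<close> only fits \<open>b\<close> to
    \<open>gronwall_iteration\<close>.\<close>
  define b where "b = (\<lambda>(_::unit) t. \<integral>x. sstep (- x) \<partial>\<mu> t)"
  have int: "integrable (\<mu> s) ?f" if "0 \<le> s" for s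
  proof -
    interpret real_distribution "\<mu> s" using rd that by simp
    show ?thesis using sstep_bounds by (intro integrable_const_bound[where B=1]) auto
  qed
  have nn: "0 \<le> b i s" for i s
    unfolding b_def using sstep_bounds by (intro Bochner_Integration.integral_nonneg) auto
  have add: "(\<integral>x. ?f x \<partial>add_law (\<mu> s) (\<mu> s)) \<le> 4 * b i s" if s: "0 \<le> s" for s i
  proof -
    interpret M: real_distribution "\<mu> s" using rd that by simp
    interpret P: pair_prob_space "\<mu> s" "\<mu> s" using real_distribution_pairD(1)[OF rd rd] s by simp
    have [measurable]: "(\<lambda>z. fst z + snd z) \<in> borel_measurable (\<mu> s \<Otimes>\<^sub>M \<mu> s)"
      using measurable_add_pair rd s by blast
    have i0: "integrable (\<mu> s \<Otimes>\<^sub>M \<mu> s) (\<lambda>z. ?f (fst z + snd z))"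
      using sstep_bounds by (intro P.integrable_const_bound[where B=1]) auto
    have "(\<integral>x. ?f x \<partial>add_law (\<mu> s) (\<mu> s)) = (\<integral>z. ?f (fst z + snd z) \<partial>(\<mu> s \<Otimes>\<^sub>M \<mu> s))"
      using rd s by (intro integral_add_law) auto
    also have "\<dots> = (\<integral>x. (\<integral>y. ?f (x + y) \<partial>\<mu> s) \<partial>\<mu> s)"
      using P.integral_fst'[OF i0] by simp
    also have "\<dots> \<le> (\<integral>x. (\<integral>y. 2 * (?f x + ?f y) \<partial>\<mu> s) \<partial>\<mu> s)"
    proof (intro integral_mono)
      show "integrable (\<mu> s) (\<lambda>x. \<integral>y. ?f (x + y) \<partial>\<mu> s)"
        using P.integrable_fst'[OF i0] by simp
      show "integrable (\<mu> s) (\<lambda>y. ?f (x + y))" for x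
        using sstep_bounds by (intro M.integrable_const_bound[where B=1]) auto
      show "?f (x + y) \<le> 2 * (?f x + ?f y)" for x y
        using sstep_sublinear[of "-x" "-y"] by simp
    qed (use int[OF s] in \<open>auto\<close>)
    also have "\<dots> = 4 * b i s"
      using int[OF s] M.prob_space by (simp add: b_def)
    finally show ?thesis .
  qed
  have hi: "((\<lambda>s. - b i s + (\<integral>x. ?f x \<partial>add_law (\<mu> s) (\<mu> s))) has_integral b i t) {0..t}" if "0 \<le> t" for t i
  proof -
    have c: "continuous_on UNIV (\<lambda>x. - sstep' (- x))"
      by (intro continuous_intros continuous_on_compose2[OF sstep'_continuous]) auto
    have d: "(?f has_real_derivative - sstep' (- x)) (at x)" for x
      by (rule DERIV_mirror[THEN iffD1, OF sstep_deriv])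
    have z: "- sstep' (- x) * indicator {0<..} x = 0" for x
      by (auto simp: indicator_def sstep_nonpos)
    note w = weak_equation[of ?f "\<lambda>x. - sstep' (- x)" 1 2 "\<lambda>_. 0" t, OF d c _ _ z continuous_on_const that]
    have A: "b i t - b i 0 = integral {0..t} (\<lambda>s. - b i s + (\<integral>x. ?f x \<partial>add_law (\<mu> s) (\<mu> s)))"
      using w(1) sstep_bounds sstep'_bound by (simp add: b_def)
    have B: "continuous_on {0..} (\<lambda>s. - b i s + (\<integral>x. ?f x \<partial>add_law (\<mu> s) (\<mu> s)))"
      using w(2) sstep_bounds sstep'_bound by (simp add: b_def)
    have "AE x in \<mu> 0. ?f x = 0"
      using DR by (auto simp: DR_model_def sstep_nonpos elim: AE_mp)
    then have "b i 0 = 0" unfolding b_def by (intro integral_eq_zero_AE)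
    moreover have "(\<lambda>s. - b i s + (\<integral>x. ?f x \<partial>add_law (\<mu> s) (\<mu> s))) integrable_on {0..t}"
      by (intro integrable_continuous_real continuous_on_subset[OF B]) auto
    ultimately show ?thesis using A by (simp add: has_integral_integral)
  qed
  \<comment> \<open>The constant 3 is 4 from the convolution minus 1 from the loss term
    \<open>- b\<close>.\<close>
  have "b () t = 0"
  proof (rule gronwall_iteration[of b 3])
    fix i and t :: real assume t: "0 \<le> t"
    interpret real_distribution "\<mu> t" using rd t by simp
    have "b i t \<le> (\<integral>x. 1 \<partial>\<mu> t)" unfolding b_def
      using int[OF t] sstep_bounds by (intro integral_mono) auto
    then show "\<bar>b i t\<bar> \<le> 1" using nn[of i t] prob_space by simp
  next
    fix i :: unit and t M :: real and k assume t: "0 \<le> t" and le: "\<And>j s. 0 \<le> s \<Longrightarrow> \<bar>b j s\<bar> \<le> M * s ^ k"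
    have "b i t \<le> 3 * (M * t ^ Suc k / Suc k)"
    proof (rule has_integral_power_bound[OF hi[OF t] t])
      fix s assume s: "s \<in> {0..t}"
      then show "- b i s + (\<integral>x. ?f x \<partial>add_law (\<mu> s) (\<mu> s)) \<le> 3 * (M * s ^ k)"
        using add[of s i] le[of s i] nn[of i s] by simp
    qed
    then show "\<bar>b i t\<bar> \<le> 3 * (M * t ^ Suc k / Suc k)" using nn[of i t] by simp
  qed (use t in auto)
  then have "AE x in \<mu> t. ?f x = 0"
    using integral_nonneg_eq_0_iff_AE[OF int[OF t]] sstep_bounds by (simp add: b_def)
  then show ?thesis
  proof (rule eventually_mono)
    show "0 \<le> x" if "sstep (- x) = 0" for x
      using sstep_pos[of "- x"] that by (cases "0 \<le> x") auto
  qed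
qed

end

text \<open>Weak continuity yields only continuity in \<open>s\<close> for a fixed level. The
  Lipschitz bound in the level, uniform in \<open>s\<close>, upgrades it to joint continuity, which
  the total derivative below requires of one partial derivative.\<close>

lemma continuous_on_Times_Lipschitz:
  fixes F :: "'a::metric_space \<Rightarrow> real \<Rightarrow> real"
  assumes F: "\<And>w. w \<in> Y \<Longrightarrow> continuous_on X (\<lambda>s. F s w)"
    and L: "\<And>s v w. s \<in> X \<Longrightarrow> v \<in> Y \<Longrightarrow> w \<in> Y \<Longrightarrow> \<bar>F s v - F s w\<bar> \<le> L * \<bar>v - w\<bar>"
  shows "continuous_on (X \<times> Y) (\<lambda>(s, w). F s w)"
  unfolding continuous_on_sequentially
proof (intro allI ballI impI)
  fix S :: "nat \<Rightarrow> 'a \<times> real" and sw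
  assume sw: "sw \<in> X \<times> Y" and S': "(\<forall>n. S n \<in> X \<times> Y) \<and> S \<longlonglongrightarrow> sw"
  obtain s w where sw_eq: "sw = (s, w)" by (cases sw)
  have S: "\<forall>n. S n \<in> X \<times> Y" "S \<longlonglongrightarrow> (s, w)" and sw: "s \<in> X" "w \<in> Y"
    using S' sw sw_eq by auto
  have S1: "(\<lambda>n. fst (S n)) \<longlonglongrightarrow> s" and S2: "(\<lambda>n. snd (S n)) \<longlonglongrightarrow> w"
    using tendsto_fst[OF S(2)] tendsto_snd[OF S(2)] by auto
  have mem: "fst (S n) \<in> X" "snd (S n) \<in> Y" for n using S(1)[rule_format, of n] by (auto simp: mem_Times_iff)
  have "(\<lambda>n. F (fst (S n)) w) \<longlonglongrightarrow> F s w"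
    using F[OF sw(2)] S1 mem sw(1) unfolding continuous_on_sequentially by (auto simp: o_def)
  moreover have "(\<lambda>n. F (fst (S n)) (snd (S n)) - F (fst (S n)) w) \<longlonglongrightarrow> 0"
  proof (rule Lim_null_comparison)
    show "\<forall>\<^sub>F n in sequentially. norm (F (fst (S n)) (snd (S n)) - F (fst (S n)) w) \<le> L * \<bar>snd (S n) - w\<bar>"
      using L mem sw by (auto intro!: always_eventually)
    have "(\<lambda>n. L * \<bar>snd (S n) - w\<bar>) \<longlonglongrightarrow> L * \<bar>w - w\<bar>"
      by (intro tendsto_intros S2)
    then show "(\<lambda>n. L * \<bar>snd (S n) - w\<bar>) \<longlonglongrightarrow> 0" by simp
  qed
  ultimately have "(\<lambda>n. F (fst (S n)) w + (F (fst (S n)) (snd (S n)) - F (fst (S n)) w)) \<longlonglongrightarrow> F s w + 0"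
    by (rule tendsto_add)
  then show "((\<lambda>(s, w). F s w) \<circ> S) \<longlonglongrightarrow> (case sw of (s, w) \<Rightarrow> F s w)"
    by (simp add: o_def case_prod_beta sw_eq)
qed

context DR begin

text \<open>This is the method of characteristics. Along \<open>w = z + t - s\<close> the transport
  term of the time derivative cancels against the derivative in the level, and only the convolution
  and loss terms remain to be integrated.\<close>

lemma smooth_mild_equation:
  assumes n: "0 < n" and z: "0 \<le> z" and t: "0 \<le> t"
  shows "((\<lambda>s. (\<integral>x. sstep (n * (x - (z + t - s))) \<partial>add_law (\<mu> s) (\<mu> s))
             - (\<integral>x. sstep (n * (x - (z + t - s))) \<partial>\<mu> s))
    has_integral ((\<integral>x. sstep (n * (x - z)) \<partial>\<mu> t) - (\<integral>x. sstep (n * (x - (z + t))) \<partial>\<mu> 0))) {0..t}"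
proof -
  \<comment> \<open>\<open>\<Phi>\<close> is the smoothed tail at level \<open>w\<close> and
    \<open>\<Gamma>\<close> its analogue for the convolution square. \<open>\<Phi>'\<close>
    integrates the derivative in \<open>x\<close>, hence is minus the derivative of
    \<open>\<Phi>\<close> in \<open>w\<close>.\<close>
  define \<Phi> where "\<Phi> = (\<lambda>s w. \<integral>x. sstep (n * (x - w)) \<partial>\<mu> s)"
  define \<Phi>' where "\<Phi>' = (\<lambda>s w. \<integral>x. n * sstep' (n * (x - w)) \<partial>\<mu> s)"
  define \<Gamma> where "\<Gamma> = (\<lambda>s w. \<integral>x. sstep (n * (x - w)) \<partial>add_law (\<mu> s) (\<mu> s))"
  have int: "integrable (\<mu> s) (\<lambda>x. sstep (n * (x - w)))" "integrable (\<mu> s) (\<lambda>x. n * sstep' (n * (x - w)))"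
    if "0 \<le> s" for s w
  proof -
    interpret real_distribution "\<mu> s" using rd that by simp
    show "integrable (\<mu> s) (\<lambda>x. sstep (n * (x - w)))"
      using sstep_bounds by (intro integrable_const_bound[where B=1]) auto
    show "integrable (\<mu> s) (\<lambda>x. n * sstep' (n * (x - w)))"
      using sstep'_bound n by (intro integrable_mult_right integrable_const_bound[where B=2]) auto
  qed
  have deriv: "((\<lambda>x. sstep (n * (x - w))) has_real_derivative n * sstep' (n * (x - w))) (at x)" for x w
  proof -
    have "((\<lambda>x. n * (x - w)) has_real_derivative n) (at x)"
      by (auto intro!: derivative_eq_intros)
    from DERIV_chain2[OF sstep_deriv this] show ?thesis by (simp add: mult.commute)
  qed
  have dcont: "continuous_on UNIV (\<lambda>x. n * sstep' (n * (x - w)))" for w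
    by (intro continuous_intros continuous_on_compose2[OF sstep'_continuous]) auto
  have d0: "n * sstep' (n * (x - w)) * indicator {0<..} x = n * sstep' (n * (x - w))" if "0 \<le> w" for x w
    using that n by (auto simp: indicator_def intro!: sstep_nonpos mult_nonneg_nonpos)
  have db: "\<bar>n * sstep' (n * (x - w))\<bar> \<le> n * 2" for x w
    using sstep'_bound n by (auto simp: abs_mult)
  have ints: "\<Phi> s w - \<Phi> 0 w = integral {0..s} (\<lambda>s. - \<Phi>' s w - \<Phi> s w + \<Gamma> s w)" if "0 \<le> w" "0 \<le> s" for s w
    unfolding \<Phi>_def \<Phi>'_def \<Gamma>_def
    by (rule weak_equation(1)[OF deriv dcont sstep_bounds(3) db d0 dcont]) (use that in auto)
  have conts: "continuous_on {0..} (\<lambda>s. - \<Phi>' s w - \<Phi> s w + \<Gamma> s w)" if "0 \<le> w" for w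
    unfolding \<Phi>_def \<Phi>'_def \<Gamma>_def
    by (rule weak_equation(2)[OF deriv dcont sstep_bounds(3) db d0 dcont order.refl]) (use that in auto)
  have \<Phi>_deriv: "((\<lambda>s. \<Phi> s w) has_real_derivative - \<Phi>' s w - \<Phi> s w + \<Gamma> s w) (at s within {0..t})"
    if "0 \<le> w" "s \<in> {0..t}" for s w
  proof -
    have "((\<lambda>s. \<Phi> 0 w + integral {0..s} (\<lambda>s. - \<Phi>' s w - \<Phi> s w + \<Gamma> s w)) has_real_derivative
        0 + (- \<Phi>' s w - \<Phi> s w + \<Gamma> s w)) (at s within {0..t})"
      using that by (intro DERIV_add DERIV_const integral_has_real_derivative continuous_on_subset[OF conts]) auto
    then have "((\<lambda>s. \<Phi> 0 w + integral {0..s} (\<lambda>s. - \<Phi>' s w - \<Phi> s w + \<Gamma> s w)) has_real_derivative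
        (- \<Phi>' s w - \<Phi> s w + \<Gamma> s w)) (at s within {0..t})" by simp
    then show ?thesis
    proof (rule has_field_derivative_transform_within[OF _ zero_less_one that(2)])
      fix u assume "u \<in> {0..t}"
      then show "\<Phi> 0 w + integral {0..u} (\<lambda>s. - \<Phi>' s w - \<Phi> s w + \<Gamma> s w) = \<Phi> u w"
        using ints[OF that(1), of u] by simp
    qed
  qed
  have \<Phi>_deriv2: "((\<lambda>w. \<Phi> s w) has_real_derivative - \<Phi>' s w) (at w within {0..})" if "s \<in> {0..t}" for s w
  proof (rule has_real_derivative_quadratic_bound)
    fix v
    have s: "0 \<le> s" using that by simp
    interpret real_distribution "\<mu> s" using rd s by simp
    have "\<Phi> s v - \<Phi> s w - - \<Phi>' s w * (v - w) =
        (\<integral>x. sstep (n * (x - v)) - sstep (n * (x - w)) - sstep' (n * (x - w)) * (n * (x - v) - n * (x - w)) \<partial>\<mu> s)"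
    proof -
      have "(\<integral>x. sstep (n * (x - v)) - sstep (n * (x - w)) - sstep' (n * (x - w)) * (n * (x - v) - n * (x - w)) \<partial>\<mu> s)
        = (\<integral>x. sstep (n * (x - v)) - sstep (n * (x - w)) - (n * sstep' (n * (x - w))) * (w - v) \<partial>\<mu> s)"
        by (intro Bochner_Integration.integral_cong) (auto simp: algebra_simps)
      also have "\<dots> = \<Phi> s v - \<Phi> s w - \<Phi>' s w * (w - v)"
        using int[OF s] by (simp add: \<Phi>_def \<Phi>'_def)
      finally show ?thesis by (simp add: algebra_simps)
    qed
    from arg_cong[OF this, of abs]
    have "\<bar>\<Phi> s v - \<Phi> s w - - \<Phi>' s w * (v - w)\<bar> =
        \<bar>\<integral>x. sstep (n * (x - v)) - sstep (n * (x - w)) - sstep' (n * (x - w)) * (n * (x - v) - n * (x - w)) \<partial>\<mu> s\<bar>" .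
    also have "\<dots> \<le> (\<integral>x. 6 * (n * (v - w))\<^sup>2 \<partial>\<mu> s)"
    proof (intro integral_abs_bound_integral)
      show "integrable (\<mu> s) (\<lambda>x. sstep (n * (x - v)) - sstep (n * (x - w)) - sstep' (n * (x - w)) * (n * (x - v) - n * (x - w)))"
      proof -
        have "integrable (\<mu> s) (\<lambda>x. sstep (n * (x - v)) - sstep (n * (x - w)) - (n * sstep' (n * (x - w))) * (w - v))"
          by (intro Bochner_Integration.integrable_diff integrable_mult_left int s)
        moreover have "(n * sstep' (n * (x - w))) * (w - v) = sstep' (n * (x - w)) * (n * (x - v) - n * (x - w))" for x
          by (simp add: algebra_simps)
        ultimately show ?thesis by (simp only:)
      qed
      fix x
      show "\<bar>sstep (n * (x - v)) - sstep (n * (x - w)) - sstep' (n * (x - w)) * (n * (x - v) - n * (x - w))\<bar> \<le> 6 * (n * (v - w))\<^sup>2"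
        using sstep_linearization[of "n * (x - v)" "n * (x - w)"]
        by (simp add: right_diff_distrib[symmetric] power2_commute power_mult_distrib)
    qed auto
    also have "\<dots> = 6 * n\<^sup>2 * (v - w)\<^sup>2" using prob_space by (simp add: power_mult_distrib)
    finally show "\<bar>\<Phi> s v - \<Phi> s w - - \<Phi>' s w * (v - w)\<bar> \<le> 6 * n\<^sup>2 * (v - w)\<^sup>2" .
  qed
  have \<Phi>'_cont: "continuous_on ({0..t} \<times> {0..}) (\<lambda>(s, w). \<Phi>' s w)"
  proof (rule continuous_on_Times_Lipschitz)
    show "continuous_on {0..t} (\<lambda>s. \<Phi>' s w)" for w
      unfolding \<Phi>'_def by (rule continuous_on_subset[OF cont_integral[OF dcont db]]) auto
    fix s v w assume s: "s \<in> {0..t}"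
    interpret real_distribution "\<mu> s" using rd s by simp
    have "\<Phi>' s v - \<Phi>' s w = (\<integral>x. n * sstep' (n * (x - v)) - n * sstep' (n * (x - w)) \<partial>\<mu> s)"
      using int(2) s by (simp add: \<Phi>'_def)
    from arg_cong[OF this, of abs]
    have "\<bar>\<Phi>' s v - \<Phi>' s w\<bar> = \<bar>\<integral>x. n * sstep' (n * (x - v)) - n * sstep' (n * (x - w)) \<partial>\<mu> s\<bar>" .
    also have "\<dots> \<le> (\<integral>x. n * (6 * (n * \<bar>v - w\<bar>)) \<partial>\<mu> s)"
    proof (intro integral_abs_bound_integral)
      fix x
      have "\<bar>sstep' (n * (x - v)) - sstep' (n * (x - w))\<bar> \<le> 6 * \<bar>n * (x - v) - n * (x - w)\<bar>"
        by (rule sstep'_Lipschitz)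
      also have "n * (x - v) - n * (x - w) = - n * (v - w)" by (simp add: algebra_simps)
      finally have "\<bar>sstep' (n * (x - v)) - sstep' (n * (x - w))\<bar> \<le> 6 * (n * \<bar>v - w\<bar>)"
        using n by (simp add: abs_mult)
      then have "n * \<bar>sstep' (n * (x - v)) - sstep' (n * (x - w))\<bar> \<le> n * (6 * (n * \<bar>v - w\<bar>))"
        using n by (intro mult_left_mono) auto
      then show "\<bar>n * sstep' (n * (x - v)) - n * sstep' (n * (x - w))\<bar> \<le> n * (6 * (n * \<bar>v - w\<bar>))"
        using n by (simp only: right_diff_distrib[symmetric] abs_mult abs_of_pos)
    qed (use int(2) s in auto)
    also have "\<dots> = (6 * n\<^sup>2) * \<bar>v - w\<bar>" using prob_space by (simp add: power2_eq_square)
    finally show "\<bar>\<Phi>' s v - \<Phi>' s w\<bar> \<le> (6 * n\<^sup>2) * \<bar>v - w\<bar>" .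
  qed
  have main: "((\<lambda>s. \<Phi> s (z + t - s)) has_vector_derivative (\<Gamma> s (z + t - s) - \<Phi> s (z + t - s))) (at s within {0..t})"
    if s: "s \<in> {0..t}" for s
  proof -
    let ?w = "z + t - s"
    have w: "0 \<le> ?w" using s z by simp
    have "((\<lambda>(s, w). \<Phi> s w) has_derivative (\<lambda>(ts, tw). (- \<Phi>' s ?w - \<Phi> s ?w + \<Gamma> s ?w) * ts
        + blinfun_scaleR_left (- \<Phi>' s ?w) tw)) (at (s, ?w) within {0..t} \<times> {0..})"
    proof (rule has_derivative_partialsI[where fy = "\<lambda>s w. blinfun_scaleR_left (- \<Phi>' s w)"])
      show "((\<lambda>s. \<Phi> s ?w) has_derivative (*) (- \<Phi>' s ?w - \<Phi> s ?w + \<Gamma> s ?w)) (at s within {0..t})"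
        using \<Phi>_deriv[OF w s] by (simp add: has_field_derivative_def)
      show "((\<lambda>w. \<Phi> s w) has_derivative blinfun_apply (blinfun_scaleR_left (- \<Phi>' s w))) (at w within {0..})"
        if "s \<in> {0..t}" for s w
      proof -
        have "(*) (- \<Phi>' s w) = blinfun_apply (blinfun_scaleR_left (- \<Phi>' s w))"
          by (auto simp: fun_eq_iff)
        then show ?thesis using \<Phi>_deriv2[OF that, of w] by (simp only: has_field_derivative_def)
      qed
      have "continuous_on ({0..t} \<times> {0..}) (\<lambda>p. blinfun_scaleR_left (- (case p of (s, w) \<Rightarrow> \<Phi>' s w)))"
        by (intro continuous_intros \<Phi>'_cont)
      then show "continuous (at (s, ?w) within {0..t} \<times> {0..}) (\<lambda>(s, w). blinfun_scaleR_left (- \<Phi>' s w))"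
        using s w by (simp add: continuous_on_eq_continuous_within case_prod_unfold)
    qed (use w in auto)
    \<comment> \<open>The total derivative holds within a rectangle. As \<open>z \<ge> 0\<close>,
      the characteristic stays inside it, and the derivative restricts to that segment.\<close>
    then have D: "((\<lambda>(s, w). \<Phi> s w) has_derivative (\<lambda>(ts, tw). (- \<Phi>' s ?w - \<Phi> s ?w + \<Gamma> s ?w) * ts
        + blinfun_scaleR_left (- \<Phi>' s ?w) tw)) (at (s, ?w) within (\<lambda>s. (s, z + t - s)) ` {0..t})"
      by (rule has_derivative_subset) (use z in auto)
    have "((\<lambda>s. (s, z + t - s)) has_derivative (\<lambda>h. (h, 0 - h))) (at s within {0..t})"
      by (auto intro!: derivative_eq_intros)
    from has_derivative_in_compose[OF this D] show ?thesis
      by (simp add: has_vector_derivative_def algebra_simps)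
  qed
  have "((\<lambda>s. \<Gamma> s (z + t - s) - \<Phi> s (z + t - s)) has_integral \<Phi> t (z + t - t) - \<Phi> 0 (z + t - 0)) {0..t}"
    by (rule fundamental_theorem_of_calculus[OF t main])
  then show ?thesis by (simp add: \<Phi>_def \<Gamma>_def)
qed

end

section \<open>From smoothed tails to tails\<close>

definition tail :: "real measure \<Rightarrow> real \<Rightarrow> real" where
  "tail M w = measure M {w<..}"

lemma tail_bounds: "real_distribution M \<Longrightarrow> 0 \<le> tail M w" "real_distribution M \<Longrightarrow> tail M w \<le> 1"
  by (auto simp: tail_def real_distribution_def prob_space.prob_le_1)

lemma sstep_integral_limit:
  assumes "real_distribution M"
  shows "(\<lambda>n. \<integral>x. sstep (real (Suc n) * (x - w)) \<partial>M) \<longlonglongrightarrow> tail M w"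
proof -
  interpret real_distribution M by fact
  have "(\<lambda>n. \<integral>x. sstep (real (Suc n) * (x - w)) \<partial>M) \<longlonglongrightarrow> (\<integral>x. indicator {w<..} x \<partial>M)"
    using sstep_limit sstep_bounds
    by (intro integral_dominated_convergence[where w="\<lambda>_. 1"]) auto
  then show ?thesis by (simp add: tail_def)
qed

lemma sstep_integral_bounds:
  assumes "real_distribution M"
  shows "0 \<le> (\<integral>x. sstep (n * (x - w)) \<partial>M)" "(\<integral>x. sstep (n * (x - w)) \<partial>M) \<le> 1"
proof -
  interpret real_distribution M by fact
  show "0 \<le> (\<integral>x. sstep (n * (x - w)) \<partial>M)" using sstep_bounds by (intro Bochner_Integration.integral_nonneg) auto
  have "(\<integral>x. sstep (n * (x - w)) \<partial>M) \<le> (\<integral>x. 1 \<partial>M)"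
    using sstep_bounds by (intro integral_mono integrable_const_bound[where B=1]) auto
  then show "(\<integral>x. sstep (n * (x - w)) \<partial>M) \<le> 1" using prob_space by simp
qed

context DR begin

text \<open>Dominated convergence as the smoothing is removed: each approximating integrand is a
  difference of two numbers in \<open>[0, 1]\<close>, hence bounded by 1. The same argument provides
  integrability in \<open>s\<close> of the limit.\<close>

lemma mild_equation:
  assumes z: "0 \<le> z" and t: "0 \<le> t"
  shows "((\<lambda>s. tail (add_law (\<mu> s) (\<mu> s)) (z + t - s) - tail (\<mu> s) (z + t - s))
    has_integral (tail (\<mu> t) z - tail (\<mu> 0) (z + t))) {0..t}"
proof -
  define f where "f = (\<lambda>n s. (\<integral>x. sstep (real (Suc n) * (x - (z + t - s))) \<partial>add_law (\<mu> s) (\<mu> s))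
             - (\<integral>x. sstep (real (Suc n) * (x - (z + t - s))) \<partial>\<mu> s))"
  have hi: "(f n has_integral ((\<integral>x. sstep (real (Suc n) * (x - z)) \<partial>\<mu> t) - (\<integral>x. sstep (real (Suc n) * (x - (z + t))) \<partial>\<mu> 0))) {0..t}" for n
    unfolding f_def using z t by (intro smooth_mild_equation) auto
  have f1: "f n integrable_on {0..t}" for n using hi by (rule has_integral_integrable)
  have f2: "norm (f n s) \<le> 1" if "s \<in> {0..t}" for n s
  proof -
    have "real_distribution (\<mu> s)" "real_distribution (add_law (\<mu> s) (\<mu> s))"
      using rd that by (auto intro: real_distribution_add_law)
    note b = sstep_integral_bounds[OF this(1), of "real (Suc n)" "z + t - s"]
      sstep_integral_bounds[OF this(2), of "real (Suc n)" "z + t - s"]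
    show ?thesis unfolding f_def real_norm_def abs_le_iff using b by linarith
  qed
  have f3: "(\<lambda>n. f n s) \<longlonglongrightarrow> tail (add_law (\<mu> s) (\<mu> s)) (z + t - s) - tail (\<mu> s) (z + t - s)" if "s \<in> {0..t}" for s
    unfolding f_def using that rd by (intro tendsto_diff sstep_integral_limit real_distribution_add_law) auto
  have h: "(\<lambda>_. 1::real) integrable_on {0..t}" by (rule integrable_const_ivl)
  note dc = dominated_convergence[OF f1 h f2 f3]
  have "(\<lambda>n. integral {0..t} (f n)) \<longlonglongrightarrow> tail (\<mu> t) z - tail (\<mu> 0) (z + t)"
    using hi t rd by (simp add: integral_unique[OF hi] del: of_nat_Suc) (intro tendsto_diff sstep_integral_limit, auto)
  from LIMSEQ_unique[OF dc(2) this] dc(1) show ?thesis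
    by (simp add: has_integral_integrable_integral)
qed

end

subsection \<open>The mixed exponential laws\<close>

text \<open>\<open>init_law\<close> is given by its values on sets, so the integral formula is built
  up from \<open>emeasure_init_law\<close> through simple functions and monotone limits.\<close>

lemma nn_integral_init_law:
  assumes "f \<in> borel_measurable borel"
  shows "(\<integral>\<^sup>+x. f x \<partial>init_law p l) =
    ennreal p * f 0 + ennreal (1 - p) * (\<integral>\<^sup>+x. f x * (ennreal (l * exp (- l * x)) * indicator {0<..} x) \<partial>lborel)"
  using assms
proof (induction rule: borel_measurable_induct)
  case (cong f g)
  then have "f = g" by auto
  with cong show ?case by simp
next
  case (set A)
  have "(\<integral>\<^sup>+x. indicator A x \<partial>init_law p l) = emeasure (init_law p l) A"
    using set by (intro nn_integral_indicator) simp
  also have "\<dots> = ennreal p * indicator A 0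
    + ennreal (1 - p) * (\<integral>\<^sup>+x\<in>A. ennreal (l * exp (- l * x)) * indicator {0<..} x \<partial>lborel)"
    using set by (rule emeasure_init_law)
  finally show ?case by (simp add: mult.commute)
next
  case (mult u c)
  have [measurable]: "u \<in> borel_measurable (init_law p l)"
    using mult by (simp add: measurable_cong_sets[OF sets_init_law refl])
  show ?case using mult
    by (simp add: nn_integral_cmult mult.assoc distrib_left mult.left_commute)
next
  case (add u v)
  have [measurable]: "u \<in> borel_measurable (init_law p l)" "v \<in> borel_measurable (init_law p l)"
    using add by (simp_all add: measurable_cong_sets[OF sets_init_law refl])
  show ?case using add
    by (simp add: nn_integral_add distrib_left distrib_right algebra_simps)
next
  case (seq U)
  let ?k = "\<lambda>x. ennreal (l * exp (- l * x)) * indicator {0<..} x"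
  have Um [measurable]: "U i \<in> borel_measurable borel" "U i \<in> borel_measurable (init_law p l)" for i
    using seq by (simp_all add: measurable_cong_sets[OF sets_init_law refl])
  have k: "incseq (\<lambda>i x. U i x * ?k x)"
    using seq(3) by (auto simp: incseq_def le_fun_def intro!: mult_right_mono)
  have "(\<integral>\<^sup>+x. (SUP i. U i) x \<partial>init_law p l) = (\<integral>\<^sup>+x. (SUP i. U i x) \<partial>init_law p l)"
    by (simp add: image_comp)
  also have "\<dots> = (SUP i. \<integral>\<^sup>+x. U i x \<partial>init_law p l)"
    by (rule nn_integral_monotone_convergence_SUP[OF seq(3)]) simp
  also have "\<dots> = (SUP i. ennreal p * U i 0 + ennreal (1 - p) * (\<integral>\<^sup>+x. U i x * ?k x \<partial>lborel))"
    by (simp only: seq)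
  also have "\<dots> = (SUP i. ennreal p * U i 0) + (SUP i. ennreal (1 - p) * (\<integral>\<^sup>+x. U i x * ?k x \<partial>lborel))"
  proof (rule ennreal_SUP_add)
    show "incseq (\<lambda>i. ennreal p * U i 0)"
      using seq(3) by (auto simp: incseq_def le_fun_def intro!: mult_left_mono)
    show "incseq (\<lambda>i. ennreal (1 - p) * (\<integral>\<^sup>+x. U i x * ?k x \<partial>lborel))"
      using k by (auto simp: incseq_def le_fun_def intro!: mult_left_mono nn_integral_mono)
  qed
  also have "(SUP i. ennreal p * U i 0) = ennreal p * (SUP i. U i 0)"
    by (simp add: SUP_mult_left_ennreal)
  also have "(SUP i. ennreal (1 - p) * (\<integral>\<^sup>+x. U i x * ?k x \<partial>lborel))
      = ennreal (1 - p) * (SUP i. \<integral>\<^sup>+x. U i x * ?k x \<partial>lborel)"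
    by (simp add: SUP_mult_left_ennreal)
  also have "(SUP i. \<integral>\<^sup>+x. U i x * ?k x \<partial>lborel) = (\<integral>\<^sup>+x. (SUP i. U i x * ?k x) \<partial>lborel)"
    by (rule nn_integral_monotone_convergence_SUP[OF k, symmetric]) simp
  also have "\<dots> = (\<integral>\<^sup>+x. (SUP i. U i) x * ?k x \<partial>lborel)"
    by (intro nn_integral_cong) (simp add: SUP_mult_right_ennreal image_comp)
  finally show ?case by (simp add: image_comp)
qed

lemma exp_mult_at_top: "0 < l \<Longrightarrow> ((\<lambda>x::real. - exp (- l * x)) \<longlongrightarrow> 0) at_top"
  by real_asymp

lemma nn_integral_exponential_tail:
  assumes l: "0 < l" and w: "0 \<le> w"
  shows "(\<integral>\<^sup>+x. ennreal (l * exp (- l * x)) * indicator {w<..} x \<partial>lborel) = ennreal (exp (- l * w))"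
proof -
  have "(\<integral>\<^sup>+x. ennreal (l * exp (- l * x)) * indicator {w<..} x \<partial>lborel) =
        (\<integral>\<^sup>+x. ennreal (l * exp (- l * x)) * indicator {w..} x \<partial>lborel)"
    by (rule nn_integral_cong_AE) (use AE_lborel_singleton[of w] in \<open>eventually_elim, auto split: split_indicator\<close>)
  also have "\<dots> = ennreal (0 - - exp (- l * w))"
    using l by (intro nn_integral_FTC_atLeast exp_mult_at_top) (auto intro!: derivative_eq_intros)
  finally show ?thesis by simp
qed

context
  fixes p l :: real
  assumes p: "0 \<le> p" "p \<le> 1" and l: "0 < l"
begin

lemma emeasure_init_law_tail:
  assumes "0 \<le> w"
  shows "emeasure (init_law p l) {w<..} = ennreal ((1 - p) * exp (- l * w))"
proof -
  have "(\<integral>\<^sup>+x\<in>{w<..}. ennreal (l * exp (- l * x)) * indicator {0<..} x \<partial>lborel) =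
        (\<integral>\<^sup>+x. ennreal (l * exp (- l * x)) * indicator {w<..} x \<partial>lborel)"
    using assms by (intro nn_integral_cong) (auto split: split_indicator)
  then show ?thesis
    using p assms by (simp add: emeasure_init_law nn_integral_exponential_tail[OF l, simplified] ennreal_mult)
qed

lemma real_distribution_init_law: "real_distribution (init_law p l)"
proof -
  have "emeasure (init_law p l) UNIV =
    ennreal p + ennreal (1 - p) * (\<integral>\<^sup>+x. ennreal (l * exp (- l * x)) * indicator {0<..} x \<partial>lborel)"
    by (simp add: emeasure_init_law)
  also have "\<dots> = 1"
    unfolding nn_integral_exponential_tail[OF l order.refl] using p by (simp flip: ennreal_plus)
  finally have "prob_space (init_law p l)" by (intro prob_spaceI) simp
  then show ?thesis by (simp add: real_distribution_def real_distribution_axioms_def)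
qed

lemma tail_init_law: "tail (init_law p l) w = (if w < 0 then 1 else (1 - p) * exp (- l * w))"
proof (cases "w < 0")
  case True
  interpret real_distribution "init_law p l" by (rule real_distribution_init_law)
  have "(\<integral>\<^sup>+x\<in>{w<..}. ennreal (l * exp (- l * x)) * indicator {0<..} x \<partial>lborel) =
        (\<integral>\<^sup>+x. ennreal (l * exp (- l * x)) * indicator {0<..} x \<partial>lborel)"
    using True by (intro nn_integral_cong) (auto split: split_indicator)
  then have "emeasure (init_law p l) {w<..} = 1"
    using True p by (simp add: emeasure_init_law nn_integral_exponential_tail[OF l order.refl, simplified] flip: ennreal_plus)
  then show ?thesis using True by (simp add: tail_def measure_def)
next
  case False
  then show ?thesis using emeasure_init_law_tail[of w] p by (simp add: tail_def measure_def)
qed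

lemma mean_init_law: "(\<integral>\<^sup>+x\<in>{0..}. ennreal x \<partial>init_law p l) = ennreal ((1 - p) / l)"
proof -
  have "(\<integral>\<^sup>+x\<in>{0..}. ennreal x \<partial>init_law p l) =
      ennreal (1 - p) * (\<integral>\<^sup>+x. (ennreal x * indicator {0..} x) * (ennreal (l * exp (- l * x)) * indicator {0<..} x) \<partial>lborel)"
    by (subst nn_integral_init_law) auto
  also have "(\<integral>\<^sup>+x. (ennreal x * indicator {0..} x) * (ennreal (l * exp (- l * x)) * indicator {0<..} x) \<partial>lborel)
      = (\<integral>\<^sup>+x. ennreal (x * (l * exp (- l * x))) * indicator {0..} x \<partial>lborel)"
    using l by (intro nn_integral_cong) (auto split: split_indicator simp: ennreal_mult)
  also have "\<dots> = ennreal (0 - - (0 + 1 / l) * exp (- l * 0))"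
  proof (rule nn_integral_FTC_atLeast)
    show "((\<lambda>x. - (x + 1 / l) * exp (- l * x)) \<longlongrightarrow> 0) at_top" using l by real_asymp
    show "((\<lambda>x. - (x + 1 / l) * exp (- l * x)) has_real_derivative x * (l * exp (- l * x))) (at x)" for x
      using l by (auto intro!: derivative_eq_intros simp: field_simps)
  qed (use l in auto)
  finally show ?thesis using p l by (simp add: ennreal_mult[symmetric])
qed

text \<open>The left side is the tail of the convolution square. For \<open>0 < y \<le> w\<close>
  the exponentials of the density and of the tail combine to a constant, which produces the term
  linear in \<open>w\<close>; for \<open>y > w\<close> the tail is 1. The atom at 0 contributes
  \<open>p\<close> times the tail at \<open>w\<close>.\<close>

lemma integral_tail_init_law:
  assumes w: "0 \<le> w"
  shows "(\<integral>y. tail (init_law p l) (w - y) \<partial>init_law p l) = (1 - p) * exp (- l * w) * (1 + p + (1 - p) * l * w)"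
proof -
  let ?G = "\<lambda>y. if w < y then 1 else (1 - p) * exp (- l * (w - y))"
  have "(\<integral>\<^sup>+y. ?G y * (ennreal (l * exp (- l * y)) * indicator {0<..} y) \<partial>lborel) =
     (\<integral>\<^sup>+y. ennreal ((1 - p) * l * exp (- l * w)) * indicator {0<..w} y
       + ennreal (l * exp (- l * y)) * indicator {w<..} y \<partial>lborel)"
  proof (intro nn_integral_cong)
    fix y
    have "ennreal (?G y) * ennreal (l * exp (- l * y)) = ennreal ((1 - p) * l * exp (- l * w))" if "\<not> w < y"
    proof -
      have "ennreal (?G y) * ennreal (l * exp (- l * y)) = ennreal (?G y * (l * exp (- l * y)))"
        using p l by (intro ennreal_mult[symmetric]) auto
      also have "?G y * (l * exp (- l * y)) = (1 - p) * l * (exp (- l * (w - y)) * exp (- l * y))"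
        using that by simp
      also have "exp (- l * (w - y)) * exp (- l * y) = exp (- l * w)"
        by (simp add: exp_add[symmetric] algebra_simps)
      finally show ?thesis .
    qed
    then show "?G y * (ennreal (l * exp (- l * y)) * indicator {0<..} y) =
      ennreal ((1 - p) * l * exp (- l * w)) * indicator {0<..w} y
       + ennreal (l * exp (- l * y)) * indicator {w<..} y"
      using w by (auto split: split_indicator)
  qed
  also have "\<dots> = (\<integral>\<^sup>+y. ennreal ((1 - p) * l * exp (- l * w)) * indicator {0<..w} y \<partial>lborel)
       + (\<integral>\<^sup>+y. ennreal (l * exp (- l * y)) * indicator {w<..} y \<partial>lborel)"
    by (rule nn_integral_add) auto
  also have "(\<integral>\<^sup>+y. ennreal ((1 - p) * l * exp (- l * w)) * indicator {0<..w} y \<partial>lborel) = ennreal ((1 - p) * l * exp (- l * w) * w)"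
    using w p l by (simp add: nn_integral_cmult ennreal_mult)
  also have "(\<integral>\<^sup>+y. ennreal (l * exp (- l * y)) * indicator {w<..} y \<partial>lborel) = ennreal (exp (- l * w))"
    using w by (rule nn_integral_exponential_tail[OF l])
  finally have *: "(\<integral>\<^sup>+y. ?G y * (ennreal (l * exp (- l * y)) * indicator {0<..} y) \<partial>lborel)
     = ennreal ((1 - p) * l * exp (- l * w) * w + exp (- l * w))"
    using p l w by (simp flip: ennreal_plus)
  have "(\<integral>\<^sup>+y. ?G y \<partial>init_law p l) = ennreal p * ?G 0
     + ennreal (1 - p) * (\<integral>\<^sup>+y. ?G y * (ennreal (l * exp (- l * y)) * indicator {0<..} y) \<partial>lborel)"
    by (rule nn_integral_init_law) measurable
  also have "\<dots> = ennreal (p * ?G 0 + (1 - p) * ((1 - p) * l * exp (- l * w) * w + exp (- l * w)))"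
    unfolding * using p l w by (simp add: ennreal_mult)
  also have "p * ?G 0 + (1 - p) * ((1 - p) * l * exp (- l * w) * w + exp (- l * w)) =
     (1 - p) * exp (- l * w) * (1 + p + (1 - p) * l * w)"
    using w by (simp add: algebra_simps)
  finally have **: "(\<integral>\<^sup>+y. ?G y \<partial>init_law p l) = ennreal ((1 - p) * exp (- l * w) * (1 + p + (1 - p) * l * w))" .
  have "(\<integral>y. ?G y \<partial>init_law p l) = (1 - p) * exp (- l * w) * (1 + p + (1 - p) * l * w)"
  proof (rule integral_eq_nn_integral[THEN trans])
    show "?G \<in> borel_measurable (init_law p l)"
      by (subst measurable_cong_sets[OF sets_init_law refl]) measurable
    show "enn2real (\<integral>\<^sup>+ y. ennreal (?G y) \<partial>init_law p l) = (1 - p) * exp (- l * w) * (1 + p + (1 - p) * l * w)"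
      unfolding ** using p l w by (intro enn2real_ennreal) auto
  qed (use p in auto)
  moreover have "tail (init_law p l) (w - y) = ?G y" for y by (simp add: tail_init_law)
  ultimately show ?thesis by simp
qed

end

subsection \<open>Uniqueness\<close>

lemma tail_add_law:
  assumes "real_distribution M" "real_distribution N"
  shows "tail (add_law M N) w = (\<integral>x. tail N (w - x) \<partial>M)" "tail (add_law M N) w = (\<integral>y. tail M (w - y) \<partial>N)"
    "integrable M (\<lambda>x. tail N (w - x))" "integrable N (\<lambda>y. tail M (w - y))"
proof -
  interpret M: real_distribution M by fact
  interpret N: real_distribution N by fact
  interpret P: pair_prob_space M N using real_distribution_pairD(1)[OF assms] by simp
  interpret A: real_distribution "add_law M N" by (rule real_distribution_add_law[OF assms])
  have [measurable]: "(\<lambda>z. fst z + snd z) \<in> borel_measurable (M \<Otimes>\<^sub>M N)"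
    using measurable_add_pair[OF assms] .
  let ?i = "\<lambda>x. indicator {w<..} x :: real"
  have i0: "integrable (M \<Otimes>\<^sub>M N) (\<lambda>z. ?i (fst z + snd z))"
    by (intro P.integrable_const_bound[where B=1]) auto
  have *: "tail (add_law M N) w = (\<integral>z. ?i (fst z + snd z) \<partial>(M \<Otimes>\<^sub>M N))"
    using integral_add_law[OF assms, of ?i] by (simp add: tail_def)
  have **: "tail N (w - x) = (\<integral>y. ?i (x + y) \<partial>N)" for x
  proof -
    have "(\<integral>y. ?i (x + y) \<partial>N) = (\<integral>y. indicator {w - x<..} y \<partial>N)"
      by (intro Bochner_Integration.integral_cong) (auto split: split_indicator)
    then show ?thesis by (simp add: tail_def)
  qed
  have ***: "tail M (w - y) = (\<integral>x. ?i (x + y) \<partial>M)" for y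
  proof -
    have "(\<integral>x. ?i (x + y) \<partial>M) = (\<integral>x. indicator {w - y<..} x \<partial>M)"
      by (intro Bochner_Integration.integral_cong) (auto split: split_indicator)
    then show ?thesis by (simp add: tail_def)
  qed
  have i1: "integrable (M \<Otimes>\<^sub>M N) (\<lambda>(x, y). ?i (x + y))"
    using i0 by (simp add: case_prod_unfold)
  show "tail (add_law M N) w = (\<integral>x. tail N (w - x) \<partial>M)" "integrable M (\<lambda>x. tail N (w - x))"
    using P.integral_fst'[OF i0] P.integrable_fst'[OF i0] * ** by simp_all
  show "tail (add_law M N) w = (\<integral>y. tail M (w - y) \<partial>N)" "integrable N (\<lambda>y. tail M (w - y))"
    using P.integral_snd[OF i1] P.integrable_snd[OF i1] * *** by (simp_all add: case_prod_unfold)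
qed

text \<open>The mixed convolution of \<open>M\<close> and \<open>N\<close> is inserted between the
  two squares. Each replacement of one factor averages differences of tails and so costs at most
  \<open>K\<close>; this is why conditioning on either summand is available in
  \<open>tail_add_law\<close>.\<close>

lemma tail_add_law_diff:
  assumes M: "real_distribution M" and N: "real_distribution N"
    and K: "\<And>u. \<bar>tail M u - tail N u\<bar> \<le> K"
  shows "\<bar>tail (add_law M M) w - tail (add_law N N) w\<bar> \<le> 2 * K"
proof -
  interpret M: real_distribution M by fact
  interpret N: real_distribution N by fact
  have "tail (add_law M M) w - tail (add_law M N) w = (\<integral>x. tail M (w - x) - tail N (w - x) \<partial>M)"
    using tail_add_law(1,3)[OF M M, of w] tail_add_law(1,3)[OF M N, of w] by simp
  also have "\<bar>\<dots>\<bar> \<le> (\<integral>x. K \<partial>M)"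
    using K tail_add_law(3)[OF M M] tail_add_law(3)[OF M N]
    by (intro integral_abs_bound_integral) auto
  finally have 1: "\<bar>tail (add_law M M) w - tail (add_law M N) w\<bar> \<le> K" using M.prob_space by simp
  have "tail (add_law M N) w - tail (add_law N N) w = (\<integral>x. tail M (w - x) - tail N (w - x) \<partial>N)"
    using tail_add_law(2,4)[OF M N, of w] tail_add_law(2,4)[OF N N, of w] by simp
  also have "\<bar>\<dots>\<bar> \<le> (\<integral>x. K \<partial>N)"
    using K tail_add_law(4)[OF M N] tail_add_law(4)[OF N N]
    by (intro integral_abs_bound_integral) auto
  finally have 2: "\<bar>tail (add_law M N) w - tail (add_law N N) w\<bar> \<le> K" using N.prob_space by simp
  from 1 2 show ?thesis by linarith
qed

text \<open>Derivatives are one-sided at time 0. The locale covers the solutions obtained by a time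
  change for \<open>p < 1\<close> as well as the stationary solution \<open>P = 1\<close>.\<close>

locale mixed_exponential_flow =
  fixes P L :: "real \<Rightarrow> real"
  assumes P: "\<And>t. 0 \<le> t \<Longrightarrow> (P has_real_derivative (1 - P t) * (L t - P t)) (at t within {0..})"
    and L: "\<And>t. 0 \<le> t \<Longrightarrow> (L has_real_derivative - (1 - P t) * L t) (at t within {0..})"
    and P_bounds: "\<And>t. 0 \<le> t \<Longrightarrow> 0 \<le> P t" "\<And>t. 0 \<le> t \<Longrightarrow> P t \<le> 1"
    and L_pos: "\<And>t. 0 \<le> t \<Longrightarrow> 0 < L t"
begin

abbreviation "\<nu> t \<equiv> init_law (P t) (L t)"

lemma rd_flow: "0 \<le> t \<Longrightarrow> real_distribution (\<nu> t)"
  by (intro real_distribution_init_law P_bounds L_pos)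

text \<open>Put \<open>w = z + t - s\<close> and divide the derivative of
  \<open>(1 - P) exp (- L w)\<close> by this function: the result is affine in \<open>w\<close>. The
  equation for \<open>L\<close> gives the coefficient \<open>(1 - P) L\<close> of \<open>w\<close>,
  and the one for \<open>P\<close> gives the constant term \<open>P\<close>. This is the convolution
  tail minus the tail, divided by the same function.\<close>

lemma mild_equation_flow:
  assumes z: "0 \<le> z" and t: "0 \<le> t"
  shows "((\<lambda>s. tail (add_law (\<nu> s) (\<nu> s)) (z + t - s) - tail (\<nu> s) (z + t - s))
    has_integral (tail (\<nu> t) z - tail (\<nu> 0) (z + t))) {0..t}"
proof -
  let ?g = "\<lambda>s. (1 - P s) * exp (- L s * (z + t - s))"
  let ?g' = "\<lambda>s. (1 - P s) * exp (- L s * (z + t - s)) * (P s + (1 - P s) * L s * (z + t - s))"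
  have "(?g' has_integral (?g t - ?g 0)) {0..t}"
  proof (rule fundamental_theorem_of_calculus[OF t])
    fix s assume s: "s \<in> {0..t}"
    have dP: "(P has_real_derivative (1 - P s) * (L s - P s)) (at s within {0..t})"
      by (rule DERIV_subset[OF P]) (use s in auto)
    have dL: "(L has_real_derivative - (1 - P s) * L s) (at s within {0..t})"
      by (rule DERIV_subset[OF L]) (use s in auto)
    have "(?g has_real_derivative ?g' s) (at s within {0..t})"
      by (rule derivative_eq_intros dP dL refl)+ (simp add: algebra_simps)
    then show "(?g has_vector_derivative ?g' s) (at s within {0..t})"
      by (simp add: has_real_derivative_iff_has_vector_derivative)
  qed
  moreover have eq: "tail (add_law (\<nu> s) (\<nu> s)) (z + t - s) - tail (\<nu> s) (z + t - s) = ?g' s" if "s \<in> {0..t}" for s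
  proof -
    have s: "0 \<le> s" and w: "0 \<le> z + t - s" using that z by auto
    show ?thesis
      unfolding tail_add_law(1)[OF rd_flow[OF s] rd_flow[OF s]]
        integral_tail_init_law[OF P_bounds(1)[OF s] P_bounds(2)[OF s] L_pos[OF s] w]
      using s w by (simp add: tail_init_law P_bounds L_pos) (simp add: algebra_simps)
  qed
  moreover have "tail (\<nu> t) z = ?g t" "tail (\<nu> 0) (z + t) = ?g 0"
    using z t P_bounds L_pos by (simp_all add: tail_init_law)
  ultimately show ?thesis by (subst has_integral_cong[OF eq]) simp_all
qed

text \<open>Both families satisfy the same mild equation from the same initial law, so the
  differences of their tails, indexed by the level, fall under \<open>gronwall_iteration\<close>.
  Equal tails mean equal distribution functions.\<close>

theorem DR_model_unique:
  assumes "DR_model (\<nu> 0) \<mu>" and t: "0 \<le> t"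
  shows "\<mu> t = \<nu> t"
proof -
  interpret DR "\<nu> 0" \<mu> by unfold_locales fact
  have \<mu>0: "\<mu> 0 = \<nu> 0" using DR by (simp add: DR_model_def)
  define d where "d = (\<lambda>z t. tail (\<mu> t) z - tail (\<nu> t) z)"
  \<comment> \<open>The mild equation is restricted to levels \<open>z \<ge> 0\<close>, but the
    convolution evaluates tails at \<open>w - y\<close>, which may be negative. There both tails
    equal 1.\<close>
  have d_neg: "d z t = 0" if "z < 0" "0 \<le> t" for z t
  proof -
    interpret real_distribution "\<mu> t" using rd that by simp
    have "AE x in \<mu> t. x \<in> {z<..}"
      using AE_nonneg[OF that(2)] by (rule eventually_mono) (use that in auto)
    then have "tail (\<mu> t) z = 1" unfolding tail_def by (subst prob_eq_1) auto
    then show ?thesis using that P_bounds L_pos by (simp add: d_def tail_init_law)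
  qed
  \<comment> \<open>The constant 3 is 2 from the convolution plus 1 from the loss term.\<close>
  have "d z t = 0" for z
  proof (rule gronwall_iteration[of d 3])
    fix z t :: real assume "0 \<le> t"
    then show "\<bar>d z t\<bar> \<le> 1"
      using tail_bounds[OF rd, of t z] tail_bounds[OF rd_flow, of t z] by (simp add: d_def abs_le_iff)
  next
    fix z t M :: real and k
    assume t: "0 \<le> t" and M: "0 \<le> M" and le: "\<And>z s. 0 \<le> s \<Longrightarrow> \<bar>d z s\<bar> \<le> M * s ^ k"
    show "\<bar>d z t\<bar> \<le> 3 * (M * t ^ Suc k / Suc k)"
    proof (cases "z < 0")
      case True
      then show ?thesis using d_neg t M by simp
    next
      case False
      then have z: "0 \<le> z" by simp
      let ?f = "\<lambda>s. (tail (add_law (\<mu> s) (\<mu> s)) (z + t - s) - tail (\<mu> s) (z + t - s))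
        - (tail (add_law (\<nu> s) (\<nu> s)) (z + t - s) - tail (\<nu> s) (z + t - s))"
      have "(?f has_integral ((tail (\<mu> t) z - tail (\<mu> 0) (z + t)) - (tail (\<nu> t) z - tail (\<nu> 0) (z + t)))) {0..t}"
        by (intro has_integral_diff mild_equation mild_equation_flow z t)
      then have f: "(?f has_integral d z t) {0..t}" by (simp add: d_def \<mu>0)
      have b: "\<bar>?f s\<bar> \<le> 3 * (M * s ^ k)" if s: "s \<in> {0..t}" for s
      proof -
        have "\<bar>tail (\<mu> s) u - tail (\<nu> s) u\<bar> \<le> M * s ^ k" for u
          using le[of s u] s by (simp add: d_def)
        then have "\<bar>tail (add_law (\<mu> s) (\<mu> s)) (z + t - s) - tail (add_law (\<nu> s) (\<nu> s)) (z + t - s)\<bar> \<le> 2 * (M * s ^ k)"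
          using s by (intro tail_add_law_diff rd rd_flow) auto
        moreover have "\<bar>tail (\<mu> s) (z + t - s) - tail (\<nu> s) (z + t - s)\<bar> \<le> M * s ^ k"
          using le[of s "z + t - s"] s by (simp add: d_def)
        ultimately show ?thesis by (simp add: abs_le_iff)
      qed
      have "d z t \<le> 3 * (M * t ^ Suc k / Suc k)"
        by (rule has_integral_power_bound[OF f t]) (use b in \<open>simp add: abs_le_iff\<close>)
      moreover have "- d z t \<le> 3 * (M * t ^ Suc k / Suc k)"
        by (rule has_integral_power_bound[OF has_integral_neg[OF f] t]) (use b in \<open>simp add: abs_le_iff\<close>)
      ultimately show ?thesis by (simp add: abs_le_iff)
    qed
  qed (use t in auto)
  then have "tail (\<mu> t) z = tail (\<nu> t) z" for z by (simp add: d_def)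
  moreover have "cdf M z = 1 - tail M z" if "real_distribution M" for M z
  proof -
    interpret real_distribution M by fact
    have "prob (space M - {..z}) = 1 - prob {..z}" by (rule prob_compl) simp
    moreover have "space M - {..z} = {z<..}" by auto
    ultimately show ?thesis by (simp add: cdf_def tail_def)
  qed
  ultimately have "cdf (\<mu> t) = cdf (\<nu> t)"
    using rd[OF t] rd_flow[OF t] by (auto simp: fun_eq_iff)
  then show ?thesis using rd[OF t] rd_flow[OF t] by (rule cdf_unique[rotated 2])
qed

end

subsection \<open>Solving the flow\<close>

text \<open>Read \<open>integral {0..x} h\<close> as the time needed to reach \<open>x\<close>; its
  inverse solves \<open>X' = 1 / h(X)\<close>. Divergence of the integral makes \<open>X\<close>
  defined for all times, and positivity of \<open>h\<close> makes it strictly increasing.\<close>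

lemma inverse_of_primitive:
  fixes h :: "real \<Rightarrow> real"
  assumes cont: "continuous_on {0..} h" and pos: "\<And>x. 0 \<le> x \<Longrightarrow> 0 < h x"
    and lim: "filterlim (\<lambda>x. integral {0..x} h) at_top at_top"
  shows "\<exists>X. X 0 = 0 \<and> (\<forall>t\<ge>0. 0 \<le> X t \<and> integral {0..X t} h = t \<and>
    (X has_real_derivative 1 / h (X t)) (at t)) \<and> filterlim X at_top at_top"
proof -
  \<comment> \<open>A constant extension of \<open>h\<close> to the left and the base point
    \<open>-1\<close> make 0 an interior point, so that \<open>X\<close> has a two-sided derivative
    at time 0 too.\<close>
  define hh where "hh = (\<lambda>x. h (max 0 x))"
  have hh_cont: "continuous_on UNIV hh"
    unfolding hh_def by (intro continuous_on_compose2[OF cont] continuous_intros) auto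
  have hh_pos: "0 < hh x" for x unfolding hh_def by (rule pos) simp
  define T where "T = (\<lambda>x. integral {-1..x} hh - integral {-1..0} hh)"
  have T_deriv: "(T has_real_derivative hh x) (at x)" if "-1 < x" for x
  proof -
    have "((\<lambda>x. integral {-1..x} hh - integral {-1..0} hh) has_real_derivative hh x - 0) (at x within {-1..x + 1})"
      using that by (intro DERIV_diff DERIV_const integral_has_real_derivative continuous_on_subset[OF hh_cont]) auto
    moreover have "at x within {-1..x + 1} = at x"
      using that by (intro at_within_interior) (auto simp: interior_atLeastAtMost_real)
    ultimately show ?thesis by (simp add: T_def)
  qed
  have T_mono: "T x < T y" if "-1 < x" "x < y" for x y
  proof (rule DERIV_pos_imp_increasing[OF that(2)])
    show "\<exists>d. (T has_real_derivative d) (at z) \<and> 0 < d" if "x \<le> z" "z \<le> y" for z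
      using T_deriv[of z] hh_pos[of z] that \<open>-1 < x\<close> by (intro exI[of _ "hh z"]) auto
  qed
  have T_eq: "T x = integral {0..x} h" if "0 \<le> x" for x
  proof -
    have "integral {-1..0} hh + integral {0..x} hh = integral {-1..x} hh"
      using that by (intro Henstock_Kurzweil_Integration.integral_combine integrable_continuous_real continuous_on_subset[OF hh_cont]) auto
    moreover have "integral {0..x} hh = integral {0..x} h"
      by (rule integral_cong) (auto simp: hh_def)
    ultimately show ?thesis by (simp add: T_def)
  qed
  have T_cont: "isCont T x" if "-1 < x" for x
    using T_deriv[OF that] by (rule DERIV_isCont)
  have T0: "T 0 = 0" by (simp add: T_def)
  have T_half: "T (-1/2) < 0" using T_mono[of "-1/2" 0] T0 by simp
  have ex: "\<exists>x>-1. T x = t" if "T (-1/2) \<le> t" for t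
  proof -
    have "eventually (\<lambda>x. t \<le> integral {0..x} h \<and> 0 \<le> x) at_top"
      using filterlim_at_top[THEN iffD1, OF lim, rule_format, of t] eventually_ge_at_top[of "0::real"]
      by eventually_elim auto
    then obtain b where b: "t \<le> integral {0..b} h" "0 \<le> b" using eventually_happens'[OF trivial_limit_at_top_linorder] by blast
    have "\<exists>x\<ge>-1/2. x \<le> b \<and> T x = t"
    proof (rule IVT)
      show "T (-1/2) \<le> t" by (rule that)
      show "t \<le> T b" using b T_eq[of b] by simp
      show "-1/2 \<le> b" using b by simp
      show "\<forall>x. -1/2 \<le> x \<and> x \<le> b \<longrightarrow> isCont T x" by (intro allI impI T_cont) auto
    qed
    then obtain x where "-1/2 \<le> x" "T x = t" by blast
    then show ?thesis by (intro exI[of _ x]) auto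
  qed
  define X where "X = (\<lambda>t. THE x. -1 < x \<and> T x = t)"
  have X_T: "X (T x) = x" if "-1 < x" for x
    unfolding X_def
  proof (rule the_equality)
    show "y = x" if "-1 < y \<and> T y = T x" for y
    proof -
      have "\<not> x < y"
      proof
        assume "x < y"
        from T_mono[OF \<open>-1 < x\<close> this] that show False by linarith
      qed
      moreover have "\<not> y < x"
      proof
        assume "y < x"
        from T_mono[OF _ this] that show False by linarith
      qed
      ultimately show ?thesis by linarith
    qed
  qed (use that in auto)
  have T_X: "-1 < X t" "T (X t) = t" if t: "T (-1/2) \<le> t" for t
  proof -
    obtain x where x: "-1 < x" "T x = t" using ex[OF t] by blast
    have "X t = x" using X_T[OF x(1)] x(2) by (simp only:)
    then show "-1 < X t" "T (X t) = t" using x by (simp_all only:)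
  qed
  have X_nonneg: "0 \<le> X t" if "0 \<le> t" for t
  proof (rule ccontr)
    assume "\<not> 0 \<le> X t"
    have h: "T (-1/2) \<le> t" using T_half that by linarith
    have "T (X t) < T 0" using T_X(1)[OF h] \<open>\<not> 0 \<le> X t\<close> by (intro T_mono) auto
    then show False using T_X(2)[OF h] that T0 by linarith
  qed
  have X_deriv: "(X has_real_derivative 1 / h (X t)) (at t)" if t: "0 \<le> t" for t
  proof -
    have x: "0 \<le> X t" by (rule X_nonneg[OF t])
    have "isCont X (T (X t))"
    proof (rule isCont_inverse_function[where d="1/2" and f=T and g=X and x="X t"])
      show "X (T z) = z" if "\<bar>z - X t\<bar> \<le> 1/2" for z using that[unfolded abs_le_iff] x by (intro X_T) linarith
      show "isCont T z" if "\<bar>z - X t\<bar> \<le> 1/2" for z using that[unfolded abs_le_iff] x by (intro T_cont) linarith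
    qed simp
    then have c: "isCont X t" using T_X(2)[of t] t T_half by simp
    have "(X has_real_derivative inverse (hh (X t))) (at t)"
    proof (rule DERIV_inverse_function[where f=T and a="T (-1/2)" and b="t + 1"])
      show "(T has_real_derivative hh (X t)) (at (X t))" using x by (intro T_deriv) auto
      show "hh (X t) \<noteq> 0" using hh_pos[of "X t"] by simp
      show "T (-1/2) < t" using T_half t by simp
      show "T (X y) = y" if "T (-1/2) < y" "y < t + 1" for y using that by (intro T_X(2)) auto
    qed (use c in auto)
    then show ?thesis using x by (simp add: hh_def inverse_eq_divide)
  qed
  show ?thesis
  proof (intro exI conjI allI impI)
    show "X 0 = 0" using X_T[of 0] T0 by simp
    show "integral {0..X t} h = t" if "0 \<le> t" for t
      using T_eq[OF X_nonneg[OF that]] T_X(2)[of t] T_half that by simp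
    show "filterlim X at_top at_top"
      unfolding filterlim_at_top_ge[where c=0]
    proof safe
      fix B :: real assume B: "0 \<le> B"
      show "\<forall>\<^sub>F t in at_top. B \<le> X t"
        using eventually_ge_at_top[of "max 0 (T B)"]
      proof eventually_elim
        case (elim t)
        then have h: "T (-1/2) \<le> t" using T_half by linarith
        have "\<not> X t < B"
        proof
          assume "X t < B"
          from T_mono[OF T_X(1)[OF h] this] show False using T_X(2)[OF h] elim by linarith
        qed
        then show ?case by simp
      qed
    qed
  qed (use X_nonneg X_deriv in auto)
qed

text \<open>Positivity of \<open>D\<close> on the half-line expresses that the flow
  \<open>x' = exp (- x) D(x)\<close> meets no equilibrium, so that \<open>x\<close> runs through the
  whole half-line.\<close>

context
  fixes p l :: real and D :: "real \<Rightarrow> real"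
  assumes p: "0 \<le> p" "p < 1" and l: "0 < l"
  defines "D \<equiv> \<lambda>x. exp x - p - l * x"
  assumes D_pos: "\<And>x. 0 \<le> x \<Longrightarrow> 0 < D x"
begin

lemma D_continuous: "continuous_on S D"
  unfolding D_def by (intro continuous_intros)

text \<open>The derivative of \<open>D\<close> is \<open>exp y - l\<close>, so the first part of the
  integrand is a logarithmic derivative; \<open>1 - p\<close> is \<open>D 0\<close>.\<close>

lemma integral_time_change:
  assumes x: "0 \<le> x"
  shows "integral {0..x} (\<lambda>y. exp y / D y) = ln (D x / (1 - p)) + l * integral {0..x} (\<lambda>y. 1 / D y)"
proof -
  have D0: "D y \<noteq> 0" if "y \<in> {0..x}" for y using D_pos[of y] that by auto
  have "((\<lambda>y. (exp y - l) / D y) has_integral (ln (D x) - ln (D 0))) {0..x}"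
  proof (rule fundamental_theorem_of_calculus[OF x])
    fix y assume y: "y \<in> {0..x}"
    have "(D has_real_derivative (exp y - l)) (at y within {0..x})"
      unfolding D_def by (auto intro!: derivative_eq_intros)
    then have "((\<lambda>y. ln (D y)) has_real_derivative inverse (D y) * (exp y - l)) (at y within {0..x})"
      using D_pos[of y] y by (intro DERIV_chain'[OF _ DERIV_ln]) auto
    then show "((\<lambda>y. ln (D y)) has_vector_derivative (exp y - l) / D y) (at y within {0..x})"
      by (simp add: has_real_derivative_iff_has_vector_derivative inverse_eq_divide)
  qed
  moreover have "((\<lambda>y. 1 / D y) has_integral (integral {0..x} (\<lambda>y. 1 / D y))) {0..x}"
    using D0 by (intro integrable_integral integrable_continuous_real continuous_intros D_continuous) auto
  ultimately have "((\<lambda>y. (exp y - l) / D y + l * (1 / D y)) has_integral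
      (ln (D x) - ln (D 0) + l * integral {0..x} (\<lambda>y. 1 / D y))) {0..x}"
    by (intro has_integral_add has_integral_mult_right)
  moreover have "(exp y - l) / D y + l * (1 / D y) = exp y / D y" for y
    by (simp add: diff_divide_distrib)
  moreover have "D 0 = 1 - p" by (simp add: D_def)
  ultimately show ?thesis
    using p D_pos[OF x] by (simp add: ln_div integral_unique)
qed

lemma time_change_at_top: "filterlim (\<lambda>x. integral {0..x} (\<lambda>y. exp y / D y)) at_top at_top"
proof (rule filterlim_at_top_mono[OF filterlim_ident])
  show "\<forall>\<^sub>F x in at_top. x \<le> integral {0..x} (\<lambda>y. exp y / D y)"
    using eventually_ge_at_top[of 0]
  proof eventually_elim
    case (elim x)
    have "integral {0..x} (\<lambda>_. 1) \<le> integral {0..x} (\<lambda>y. exp y / D y)"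
    proof (rule integral_le)
      show "(\<lambda>y. exp y / D y) integrable_on {0..x}"
        using D_pos by (intro integrable_continuous_real continuous_intros D_continuous) (auto simp: less_imp_neq[symmetric])
      show "1 \<le> exp y / D y" if "y \<in> {0..x}" for y
      proof -
        have "0 \<le> l * y" using l that by simp
        then show ?thesis using D_pos[of y] that p by (simp add: pos_le_divide_eq) (simp add: D_def)
      qed
    qed auto
    then show ?case using elim by simp
  qed
qed

text \<open>The normalized mean is computed exactly at every time: the factor \<open>D (X t)\<close>
  from the mean cancels against the one in \<open>exp (- t)\<close>. The limit then concerns only
  the integral of \<open>1 / D\<close> up to \<open>X t\<close>.\<close>

theorem free_energy_subcritical:
  assumes \<mu>: "DR_model (init_law p l) \<mu>"
    and k: "((\<lambda>x. integral {0..x} (\<lambda>y. 1 / D y)) \<longlongrightarrow> k) at_top"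
  shows "free_energy \<mu> = ennreal ((1 - p) / l * exp (- l * k))"
proof -
  let ?h = "\<lambda>y. exp y / D y"
  have h: "continuous_on {0..} ?h" "\<And>x. 0 \<le> x \<Longrightarrow> 0 < ?h x"
    using D_pos by (auto intro!: continuous_intros D_continuous simp: less_imp_neq[symmetric])
  obtain X where X: "X 0 = 0" "\<And>t. 0 \<le> t \<Longrightarrow> 0 \<le> X t" "\<And>t. 0 \<le> t \<Longrightarrow> integral {0..X t} ?h = t"
    "\<And>t. 0 \<le> t \<Longrightarrow> (X has_real_derivative 1 / ?h (X t)) (at t)" "filterlim X at_top at_top"
    using inverse_of_primitive[OF h time_change_at_top] by auto
  define P where "P = (\<lambda>t. (p + l * X t) * exp (- X t))"
  define L where "L = (\<lambda>t. l * exp (- X t))"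
  \<comment> \<open>By this identity \<open>X' = 1 - P\<close>, so \<open>X\<close> is the clock in
    which the system becomes linear.\<close>
  have P1: "1 - P t = 1 / ?h (X t)" for t
  proof -
    have "1 / ?h (X t) = D (X t) * exp (- X t)" by (simp add: exp_minus inverse_eq_divide)
    also have "\<dots> = exp (X t) * exp (- X t) - (p + l * X t) * exp (- X t)" by (simp add: D_def algebra_simps)
    also have "\<dots> = 1 - P t" by (simp add: P_def exp_minus_inverse)
    finally show ?thesis by simp
  qed
  have X': "(X has_real_derivative (1 - P t)) (at t within {0..})" if "0 \<le> t" for t
    unfolding P1 by (rule DERIV_subset[OF X(4)[OF that]]) simp
  interpret mixed_exponential_flow P L
  proof
    fix t :: real assume t: "0 \<le> t"
    have "(P has_real_derivative (l * (1 - P t)) * exp (- X t) + (p + l * X t) * (exp (- X t) * (- (1 - P t)))) (at t within {0..})"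
      unfolding P_def by (rule derivative_eq_intros X'[OF t, unfolded P_def] refl)+ simp
    then show "(P has_real_derivative (1 - P t) * (L t - P t)) (at t within {0..})"
      by (rule DERIV_cong) (simp add: L_def P_def algebra_simps)
    have "(L has_real_derivative l * (exp (- X t) * (- (1 - P t)))) (at t within {0..})"
      unfolding L_def by (rule derivative_eq_intros X'[OF t] refl)+ simp
    then show "(L has_real_derivative - (1 - P t) * L t) (at t within {0..})"
      by (rule DERIV_cong) (simp add: L_def algebra_simps)
    show "0 \<le> P t" unfolding P_def using p l X(2)[OF t] by simp
    have "0 < 1 - P t" unfolding P1 using D_pos[OF X(2)[OF t]] by simp
    then show "P t \<le> 1" by simp
    show "0 < L t" using l by (simp add: L_def)
  qed
  have 0: "\<nu> 0 = init_law p l" by (simp add: P_def L_def X(1))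
  have \<mu>_eq: "\<mu> t = \<nu> t" if "0 \<le> t" for t
    using that \<mu> by (intro DR_model_unique) (simp_all add: 0)
  have val: "ennreal (exp (- t)) * (\<integral>\<^sup>+x\<in>{0..}. ennreal x \<partial>\<mu> t)
      = ennreal ((1 - p) / l * exp (- l * integral {0..X t} (\<lambda>y. 1 / D y)))" if t: "0 \<le> t" for t
  proof -
    let ?k = "integral {0..X t} (\<lambda>y. 1 / D y)"
    have x: "0 \<le> X t" by (rule X(2)[OF t])
    have "t = ln (D (X t) / (1 - p)) + l * ?k"
      using X(3)[OF t] integral_time_change[OF x] by simp
    then have "exp (- t) = exp (- ln (D (X t) / (1 - p)) + - l * ?k)" by simp
    also have "\<dots> = (1 - p) / D (X t) * exp (- l * ?k)"
      unfolding exp_add using D_pos[OF x] p by (simp add: exp_minus)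
    finally have e: "exp (- t) = (1 - p) / D (X t) * exp (- l * ?k)" .
    have "(1 - P t) / L t = D (X t) / l"
      unfolding P1 L_def by (simp add: exp_minus divide_simps)
    then have "(\<integral>\<^sup>+x\<in>{0..}. ennreal x \<partial>\<mu> t) = ennreal (D (X t) / l)"
      using t by (simp add: \<mu>_eq mean_init_law P_bounds L_pos)
    then have "ennreal (exp (- t)) * (\<integral>\<^sup>+x\<in>{0..}. ennreal x \<partial>\<mu> t) = ennreal (exp (- t) * (D (X t) / l))"
      using D_pos[OF x] l by (simp add: ennreal_mult[symmetric])
    also have "exp (- t) * (D (X t) / l) = (1 - p) / l * exp (- l * ?k)"
      unfolding e using D_pos[OF x] by simp
    finally show ?thesis .
  qed
  have "((\<lambda>t. ennreal ((1 - p) / l * exp (- l * integral {0..X t} (\<lambda>y. 1 / D y)))) \<longlongrightarrow> ennreal ((1 - p) / l * exp (- l * k))) at_top"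
    by (intro tendsto_intros tendsto_ennrealI filterlim_compose[OF k X(5)])
  then have "((\<lambda>t. ennreal (exp (- t)) * (\<integral>\<^sup>+x\<in>{0..}. ennreal x \<partial>\<mu> t)) \<longlongrightarrow> ennreal ((1 - p) / l * exp (- l * k))) at_top"
    by (rule Lim_transform_eventually) (use eventually_ge_at_top[of "0::real"] in \<open>eventually_elim, simp add: val\<close>)
  then show ?thesis unfolding free_energy_def by (intro tendsto_Lim) auto
qed

end

lemma free_energy_point_mass:
  assumes l: "0 < l" and \<mu>: "DR_model (init_law 1 l) \<mu>"
  shows "free_energy \<mu> = 0"
proof -
  interpret mixed_exponential_flow "\<lambda>_. 1" "\<lambda>_. l"
    by unfold_locales (use l in auto)
  have "\<mu> t = init_law 1 l" if "0 \<le> t" for t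
    using DR_model_unique[of \<mu> t] \<mu> that by simp
  then have "((\<lambda>t. ennreal (exp (- t)) * (\<integral>\<^sup>+x\<in>{0..}. ennreal x \<partial>\<mu> t)) \<longlongrightarrow> 0) at_top"
    using mean_init_law[of 1 l] l
    by (intro tendsto_eventually) (use eventually_ge_at_top[of "0::real"] in \<open>eventually_elim, simp\<close>)
  then show ?thesis unfolding free_energy_def by (intro tendsto_Lim) auto
qed

subsection \<open>Asymptotics of the reciprocal integrals\<close>

lemma dominated_convergence_at_right:
  fixes f :: "real \<Rightarrow> 'a::euclidean_space \<Rightarrow> real"
  assumes f: "\<And>e. 0 < e \<Longrightarrow> f e integrable_on S" and h: "h integrable_on S"
    and le: "\<And>e x. 0 < e \<Longrightarrow> x \<in> S \<Longrightarrow> \<bar>f e x\<bar> \<le> h x"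
    and lim: "\<And>x. x \<in> S \<Longrightarrow> ((\<lambda>e. f e x) \<longlongrightarrow> g x) (at_right 0)"
  shows "((\<lambda>e. integral S (f e)) \<longlongrightarrow> integral S g) (at_right 0)"
  unfolding tendsto_at_iff_sequentially
proof (intro allI impI)
  fix X :: "nat \<Rightarrow> real" assume X: "\<forall>i. X i \<in> {0<..} - {0}" "X \<longlonglongrightarrow> 0"
  have "(\<lambda>n. f (X n) x) \<longlonglongrightarrow> g x" if "x \<in> S" for x
    using lim[OF that] X unfolding tendsto_at_iff_sequentially by (auto simp: o_def)
  then show "((\<lambda>e. integral S (f e)) \<circ> X) \<longlonglongrightarrow> integral S g"
    unfolding o_def using X f le by (intro dominated_convergence(2)[OF _ h]) auto
qed

lemma improper_integral_limit:
  fixes f h :: "real \<Rightarrow> real"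
  assumes f: "continuous_on {a..} f" and h: "h integrable_on {a..}"
    and le: "\<And>x. a \<le> x \<Longrightarrow> \<bar>f x\<bar> \<le> h x"
  shows "f integrable_on {a..}" "((\<lambda>x. integral {a..x} f) \<longlongrightarrow> integral {a..} f) at_top"
proof -
  let ?f = "\<lambda>b x. if x \<in> {a..b} then f x else 0"
  have eq: "integral {a..} (?f b) = integral {a..b} f" for b
  proof -
    have "integral {a..} (?f b) = integral ({a..b} \<inter> {a..}) f" by (rule integral_restrict_Int)
    also have "{a..b} \<inter> {a..} = {a..b}" by auto
    finally show ?thesis .
  qed
  have i: "?f b integrable_on {a..}" for b
  proof -
    have "f integrable_on {a..b}"
      by (intro integrable_continuous_real continuous_on_subset[OF f]) auto
    moreover have "{a..b} \<inter> {a..} = {a..b}" by auto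
    ultimately show ?thesis using integrable_restrict_Int[of "{a..b}" f "{a..}"] by simp
  qed
  have nn: "0 \<le> h x" if "a \<le> x" for x using le[OF that] by linarith
  have dc: "f integrable_on {a..}" "(\<lambda>n. integral {a..} (?f (X n))) \<longlonglongrightarrow> integral {a..} f"
    if X: "filterlim X at_top sequentially" for X :: "nat \<Rightarrow> real"
  proof -
    have conv: "(\<lambda>n. ?f (X n) x) \<longlonglongrightarrow> f x" if "x \<in> {a..}" for x
      using X[unfolded filterlim_at_top, rule_format, of x]
      by (intro tendsto_eventually, elim eventually_mono) (use that in auto)
    show "f integrable_on {a..}" "(\<lambda>n. integral {a..} (?f (X n))) \<longlonglongrightarrow> integral {a..} f"
      using dominated_convergence[of "\<lambda>n. ?f (X n)" "{a..}" h f, OF i h _ conv] le nn by auto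
  qed
  show "f integrable_on {a..}" by (rule dc(1)[OF filterlim_real_sequentially])
  show "((\<lambda>x. integral {a..x} f) \<longlongrightarrow> integral {a..} f) at_top"
    using dc(2)[unfolded eq] by (intro tendsto_at_topI_sequentially)
qed

text \<open>For \<open>l \<ge> 1\<close> the shift \<open>x = ln l + w\<close> turns
  \<open>D\<close> into \<open>l * (exp_rem w + e)\<close> with
  \<open>e = (l - l * ln l - p) / l\<close>, so one function serves all these
  \<open>l\<close>.\<close>

definition exp_rem :: "real \<Rightarrow> real" where
  "exp_rem w = exp w - 1 - w"

lemma exp_rem_cubic_error:
  "0 \<le> exp_rem w - w\<^sup>2 / 2 - w ^ 3 / 6"
  "\<bar>w\<bar> \<le> 1 \<Longrightarrow> exp_rem w - w\<^sup>2 / 2 - w ^ 3 / 6 \<le> w ^ 4"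
proof -
  obtain t where t: "\<bar>t\<bar> \<le> \<bar>w\<bar>" "exp w = (\<Sum>m<4. w ^ m / fact m) + exp t / fact 4 * w ^ 4"
    using Maclaurin_exp_le[of w 4] by blast
  have "(\<Sum>m<4. w ^ m / fact m) = 1 + w + w\<^sup>2 / 2 + w ^ 3 / 6"
    by (simp add: eval_nat_numeral)
  with t(2) have eq: "exp_rem w - w\<^sup>2 / 2 - w ^ 3 / 6 = exp t / 24 * w ^ 4"
    by (simp add: exp_rem_def fact_numeral)
  have "0 \<le> exp t / 24 * w ^ 4" by simp
  then show "0 \<le> exp_rem w - w\<^sup>2 / 2 - w ^ 3 / 6" by (simp only: eq)
  assume "\<bar>w\<bar> \<le> 1"
  then have "exp t \<le> exp 1" using t(1) by simp
  also have "\<dots> \<le> 24" using exp_le by simp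
  finally have "exp t / 24 * w ^ 4 \<le> 1 * w ^ 4" by (intro mult_right_mono) auto
  then show "exp_rem w - w\<^sup>2 / 2 - w ^ 3 / 6 \<le> w ^ 4" using eq by simp
qed

text \<open>The cubic term is nonnegative for \<open>w \<ge> 0\<close>, and for
  \<open>-1 \<le> w\<close> it takes at most \<open>w^2 / 6\<close> away from
  \<open>w^2 / 2\<close>.\<close>

lemma exp_rem_lower:
  shows "0 \<le> w \<Longrightarrow> w\<^sup>2 / 2 \<le> exp_rem w" and "-1 \<le> w \<Longrightarrow> w\<^sup>2 / 3 \<le> exp_rem w"
proof -
  note e = exp_rem_cubic_error(1)[of w]
  show "w\<^sup>2 / 2 \<le> exp_rem w" if "0 \<le> w"
    using e zero_le_power[OF that, of 3] by linarith
  assume "-1 \<le> w"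
  then have "0 \<le> w\<^sup>2 * (1 + w) / 6" by simp
  also have "\<dots> = w\<^sup>2 / 6 + w ^ 3 / 6" by (simp add: power2_eq_square power3_eq_cube algebra_simps)
  finally show "w\<^sup>2 / 3 \<le> exp_rem w" using e by linarith
qed

lemma exp_rem_nonneg: "0 \<le> exp_rem w"
  unfolding exp_rem_def using exp_ge_add_one_self[of w] by linarith

lemma exp_rem_continuous [continuous_intros]:
  "continuous_on S f \<Longrightarrow> continuous_on S (\<lambda>x. exp_rem (f x))"
  unfolding exp_rem_def by (intro continuous_intros)

text \<open>
  The quadratic and cubic Taylor terms of \<^term>\<open>exp_rem\<close> are subtracted: the cubic one contributes
  the logarithm that produces the power in front of the exponential when \<open>a = 0\<close>.
\<close>

definition cubic_model :: "real \<Rightarrow> real \<Rightarrow> real" where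
  "cubic_model e w = 1 / (e + w\<^sup>2 / 2) - (w ^ 3 / 6) / (e + w\<^sup>2 / 2)\<^sup>2"

text \<open>With \<open>s = e + w^2 / 2\<close>, so \<open>ds = w dw\<close>, the cubic term is
  \<open>(s - e) / (3 s^2) ds\<close>; it integrates to \<open>(ln s + e / s) / 3\<close>.\<close>

definition cubic_model_prim :: "real \<Rightarrow> real \<Rightarrow> real" where
  "cubic_model_prim e w = sqrt (2 / e) * arctan (w / sqrt (2 * e))
     - (ln (e + w\<^sup>2 / 2) + e / (e + w\<^sup>2 / 2)) / 3"

lemma half_square_pos: "0 < e \<Longrightarrow> 0 < e + (w::real)\<^sup>2 / 2"
  by (rule add_pos_nonneg) auto

lemma cubic_model_prim_deriv:
  assumes e: "0 < e"
  shows "(cubic_model_prim e has_real_derivative cubic_model e w) (at w within S)"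
proof -
  define s where "s = e + w\<^sup>2 / 2"
  have s: "0 < s" unfolding s_def by (rule half_square_pos[OF e])
  have q: "((\<lambda>w. e + w\<^sup>2 / 2) has_real_derivative w) (at w within S)"
    by (auto intro!: derivative_eq_intros)
  have d1: "((\<lambda>w. sqrt (2 / e) * arctan (w / sqrt (2 * e))) has_real_derivative
     sqrt (2 / e) * (inverse (1 + (w / sqrt (2 * e))\<^sup>2) * (1 / sqrt (2 * e)))) (at w within S)"
    by (intro DERIV_cmult DERIV_chain'[OF _ DERIV_arctan] DERIV_cdivide DERIV_ident)
  define q where "q = inverse (1 + (w / sqrt (2 * e))\<^sup>2)"
  have "sqrt (2 / e) * (1 / sqrt (2 * e)) = 1 / e"
    using e by (simp add: real_sqrt_divide real_sqrt_mult)
  then have "sqrt (2 / e) * (q * (1 / sqrt (2 * e))) = 1 / e * q"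
    by (metis mult.commute mult.left_commute)
  also have "\<dots> = 1 / s"
  proof -
    have "e * (1 + (w / sqrt (2 * e))\<^sup>2) = s"
      using e by (simp add: power_divide s_def distrib_left)
    then show ?thesis by (simp add: inverse_eq_divide q_def)
  qed
  finally have d1': "((\<lambda>w. sqrt (2 / e) * arctan (w / sqrt (2 * e))) has_real_derivative 1 / s) (at w within S)"
    using d1 by (simp add: q_def)
  have d2: "((\<lambda>w. ln (e + w\<^sup>2 / 2)) has_real_derivative inverse s * w) (at w within S)"
    using q s by (intro DERIV_chain'[OF q, of ln, unfolded s_def[symmetric]] DERIV_ln)
  have d3: "((\<lambda>w. e / (e + w\<^sup>2 / 2)) has_real_derivative (0 * s - e * w) / (s * s)) (at w within S)"
    using DERIV_divide[OF DERIV_const q, of e] s by (simp add: s_def)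
  have d4: "(cubic_model_prim e has_real_derivative
      1 / s - (inverse s * w + (0 * s - e * w) / (s * s)) / 3) (at w within S)"
    unfolding cubic_model_prim_def by (intro DERIV_diff DERIV_cdivide DERIV_add d1' d2 d3)
  have "inverse s * w + (0 * s - e * w) / (s * s) = ((s - e) * w) / s\<^sup>2"
    using s by (simp add: field_simps power2_eq_square)
  also have "(s - e) * w = w ^ 3 / 2" by (simp add: s_def power2_eq_square power3_eq_cube)
  finally have "1 / s - (inverse s * w + (0 * s - e * w) / (s * s)) / 3 = cubic_model e w"
    by (simp add: cubic_model_def s_def)
  with d4 show ?thesis by (rule DERIV_cong)
qed

text \<open>The model is the expansion of \<open>1 / (h + g)\<close> to first order in
  \<open>g\<close>, with \<open>g\<close> replaced by \<open>w^3 / 6\<close>. The replacement error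
  is of order \<open>w^4\<close> over \<open>r h\<close>, the second-order error of order
  \<open>w^6\<close> over \<open>r h^2\<close>. Since \<open>r\<close> and \<open>h\<close> dominate
  multiples of \<open>w^2\<close>, each is at most 6, uniformly in \<open>e\<close>.\<close>

lemma reciprocal_minus_model:
  assumes e: "0 \<le> e" and w: "\<bar>w\<bar> \<le> 1"
  shows "\<bar>1 / (exp_rem w + e) - cubic_model e w\<bar> \<le> 12"
proof (cases "w = 0")
  \<comment> \<open>At \<open>w = 0\<close> both terms are \<open>1 / e\<close>, and for
    \<open>e = 0\<close> both are 0 by the convention on division.\<close>
  case True
  then show ?thesis by (simp add: exp_rem_def cubic_model_def)
next
  case False
  define r h g where "r = exp_rem w + e" and "h = e + w\<^sup>2 / 2" and "g = exp_rem w - w\<^sup>2 / 2"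
  have w2: "0 < w\<^sup>2" using False by simp
  have r: "w\<^sup>2 / 3 \<le> r" using exp_rem_lower(2)[of w] w e by (simp add: r_def abs_le_iff)
  have h: "w\<^sup>2 / 2 \<le> h" using e by (simp add: h_def)
  have pos: "0 < r" "0 < h" using r h w2 by linarith+
  have g1: "\<bar>w ^ 3 / 6 - g\<bar> \<le> w ^ 4"
    using exp_rem_cubic_error[of w] w by (simp add: g_def abs_le_iff)
  have g2: "\<bar>g\<bar> \<le> 2 * \<bar>w\<bar> ^ 3"
  proof -
    have "\<bar>g\<bar> \<le> \<bar>w ^ 3 / 6\<bar> + \<bar>w ^ 3 / 6 - g\<bar>" by linarith
    also have "\<dots> \<le> \<bar>w\<bar> ^ 3 / 6 + \<bar>w\<bar> ^ 4" using g1 by (simp add: power_abs power_even_abs)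
    also have "\<bar>w\<bar> ^ 4 \<le> \<bar>w\<bar> ^ 3" using w by (intro power_decreasing) auto
    finally show ?thesis by linarith
  qed
  have rh: "r = h + g" by (simp add: r_def h_def g_def)
  have "1 / r - cubic_model e w = ((w ^ 3 / 6 - g) * h + (w ^ 3 / 6) * g) / (r * h\<^sup>2)"
  proof -
    have "cubic_model e w = (h - w ^ 3 / 6) / h\<^sup>2"
      unfolding cubic_model_def h_def[symmetric] using pos by (simp add: diff_divide_distrib power2_eq_square)
    then have "1 / r - cubic_model e w = (h\<^sup>2 - r * (h - w ^ 3 / 6)) / (r * h\<^sup>2)"
      using pos diff_frac_eq[of r "h\<^sup>2" 1 "h - w ^ 3 / 6"] by (simp add: mult.commute)
    also have "h\<^sup>2 - r * (h - w ^ 3 / 6) = (w ^ 3 / 6 - g) * h + (w ^ 3 / 6) * g"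
      by (simp add: rh algebra_simps power2_eq_square)
    finally show ?thesis .
  qed
  also have "\<dots> = (w ^ 3 / 6 - g) / (r * h) + (w ^ 3 / 6) * g / (r * h\<^sup>2)"
    using pos by (simp add: add_divide_distrib power2_eq_square)
  finally have "\<bar>1 / r - cubic_model e w\<bar> \<le> \<bar>(w ^ 3 / 6 - g) / (r * h)\<bar> + \<bar>(w ^ 3 / 6) * g / (r * h\<^sup>2)\<bar>"
    by (simp only: abs_triangle_ineq)
  also have "\<bar>(w ^ 3 / 6 - g) / (r * h)\<bar> \<le> 6"
  proof -
    have "w ^ 4 = 6 * (w\<^sup>2 / 3 * (w\<^sup>2 / 2))" by (simp add: eval_nat_numeral)
    also have "\<dots> \<le> 6 * (r * h)" using r h w2 pos by (intro mult_left_mono mult_mono) auto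
    finally show ?thesis using g1 pos by (simp add: abs_divide abs_mult divide_simps)
  qed
  also have "\<bar>(w ^ 3 / 6) * g / (r * h\<^sup>2)\<bar> \<le> 6"
  proof -
    have "\<bar>(w ^ 3 / 6) * g\<bar> = \<bar>w\<bar> ^ 3 / 6 * \<bar>g\<bar>" by (simp add: abs_mult power_abs)
    also have "\<dots> \<le> \<bar>w\<bar> ^ 3 / 6 * (2 * \<bar>w\<bar> ^ 3)" using g2 by (intro mult_left_mono) auto
    also have "\<dots> = \<bar>w\<bar> ^ 6 / 3" by (simp add: power_add[symmetric])
    also have "\<dots> = 4 * (w\<^sup>2 / 3 * (w\<^sup>2 / 2)\<^sup>2)" by (simp add: power_even_abs eval_nat_numeral)
    also have "\<dots> \<le> 4 * (r * h\<^sup>2)" using r h w2 pos by (intro mult_left_mono mult_mono power_mono) auto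
    finally have "\<bar>(w ^ 3 / 6) * g\<bar> \<le> 6 * (r * h\<^sup>2)" using mult_pos_pos[OF pos(1) zero_less_power[OF pos(2), of 2]] by linarith
    then show ?thesis using pos unfolding abs_divide by (simp add: pos_divide_le_eq)
  qed
  finally show ?thesis by (simp add: r_def)
qed

section \<open>Reciprocal integrals near a quadratic minimum\<close>

lemma integrable_inverse_square: "(\<lambda>x::real. C / x\<^sup>2) integrable_on {1..}"
proof -
  have "((\<lambda>x::real. 1 / x\<^sup>2) has_integral 1 / (real (2 - 1) * 1 ^ (2 - 1))) {1..}"
    by (rule has_integral_inverse_power_to_inf) auto
  from has_integral_mult_right[OF this, of C] show ?thesis by (auto simp: integrable_on_def)
qed

text \<open>The integral over \<open>{-a..}\<close>, to be used with \<open>a = ln l\<close>. The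
  cut at 1 separates the part that blows up as \<open>e\<close> tends to 0 from a tail with the
  majorant \<open>2 / w^2\<close>.\<close>

definition exp_rem_integral :: "real \<Rightarrow> real \<Rightarrow> real" where
  "exp_rem_integral a e = integral {-a..1} (\<lambda>w. 1 / (exp_rem w + e)) + integral {1..} (\<lambda>w. 1 / (exp_rem w + e))"

lemma exp_rem_tail_bound:
  assumes "0 < e" "1 \<le> w"
  shows "\<bar>1 / (exp_rem w + e)\<bar> \<le> 2 / w\<^sup>2"
proof -
  have "w\<^sup>2 / 2 \<le> exp_rem w + e" "0 < w\<^sup>2 / 2" using exp_rem_lower(1)[of w] assms by auto
  then have "1 / (exp_rem w + e) \<le> 1 / (w\<^sup>2 / 2)" by (intro divide_left_mono mult_pos_pos) linarith+
  moreover have "0 < exp_rem w + e" using exp_rem_nonneg[of w] assms by linarith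
  ultimately show ?thesis by simp
qed

lemma exp_rem_reciprocal_continuous:
  assumes "0 < e"
  shows "continuous_on S (\<lambda>w. 1 / (exp_rem w + e))"
proof -
  have "exp_rem w + e \<noteq> 0" for w using exp_rem_nonneg[of w] assms by linarith
  then show ?thesis by (intro continuous_intros) auto
qed

lemma exp_rem_integral_limit:
  assumes a: "-1 \<le> a" and e: "0 < e"
  shows "((\<lambda>b. integral {-a..b} (\<lambda>w. 1 / (exp_rem w + e))) \<longlongrightarrow> exp_rem_integral a e) at_top"
proof -
  let ?f = "\<lambda>w. 1 / (exp_rem w + e)"
  have "((\<lambda>b. integral {-a..1} ?f + integral {1..b} ?f) \<longlongrightarrow> exp_rem_integral a e) at_top"
    unfolding exp_rem_integral_def
    by (intro tendsto_add tendsto_const improper_integral_limit(2)[OF exp_rem_reciprocal_continuous[OF e] integrable_inverse_square[of 2]]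
         exp_rem_tail_bound[OF e])
  moreover have "\<forall>\<^sub>F b in at_top. integral {-a..1} ?f + integral {1..b} ?f = integral {-a..b} ?f"
    using eventually_ge_at_top[of "1::real"]
    by eventually_elim (use a in \<open>auto intro!: Henstock_Kurzweil_Integration.integral_combine integrable_continuous_real exp_rem_reciprocal_continuous[OF e]\<close>)
  ultimately show ?thesis by (rule Lim_transform_eventually)
qed

text \<open>Dominated convergence with majorants 12 and \<open>2 / w^2\<close>. The bound 12 is
  valid for \<open>\<bar>w\<bar> \<le> 1\<close>, whence \<open>a \<le> 1\<close>; with
  \<open>a = ln l\<close> this is where \<open>l < exp 1\<close> enters.\<close>

lemma exp_rem_integral_asymp:
  assumes a: "0 \<le> a" "a \<le> 1"
  shows "\<exists>c. ((\<lambda>e. exp_rem_integral a e - (cubic_model_prim e 1 - cubic_model_prim e (-a))) \<longlongrightarrow> c) (at_right 0)"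
proof -
  let ?f = "\<lambda>e w. 1 / (exp_rem w + e)" and ?m = cubic_model
  have fi: "?f e integrable_on {-a..1}" if "0 < e" for e
    by (intro integrable_continuous_real exp_rem_reciprocal_continuous that)
  have mi: "(?m e has_integral (cubic_model_prim e 1 - cubic_model_prim e (-a))) {-a..1}" if "0 < e" for e
    using a cubic_model_prim_deriv[OF that]
    by (intro fundamental_theorem_of_calculus) (auto simp: has_real_derivative_iff_has_vector_derivative)
  have "((\<lambda>e. integral {-a..1} (\<lambda>w. ?f e w - ?m e w)) \<longlongrightarrow> integral {-a..1} (\<lambda>w. ?f 0 w - ?m 0 w)) (at_right 0)"
  proof (rule dominated_convergence_at_right[where h="\<lambda>_. 12"])
    show "(\<lambda>w. ?f e w - ?m e w) integrable_on {-a..1}" if "0 < e" for e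
      using fi[OF that] mi[OF that] by (auto intro: integrable_diff)
    show "\<bar>?f e w - ?m e w\<bar> \<le> 12" if "0 < e" "w \<in> {-a..1}" for e w
      using that a by (intro reciprocal_minus_model) auto
    fix w assume w: "w \<in> {-a..1}"
    show "((\<lambda>e. ?f e w - ?m e w) \<longlongrightarrow> ?f 0 w - ?m 0 w) (at_right 0)"
    proof (cases "w = 0")
      case True
      then show ?thesis by (simp add: exp_rem_def cubic_model_def)
    next
      case False
      then have "0 < w\<^sup>2" by simp
      moreover have "w\<^sup>2 / 3 \<le> exp_rem w" using w a by (intro exp_rem_lower) auto
      ultimately have "exp_rem w + 0 \<noteq> 0" "0 + w\<^sup>2 / 2 \<noteq> 0" by linarith+
      then show ?thesis unfolding cubic_model_def by (intro tendsto_intros) auto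
    qed
  qed auto
  moreover have "((\<lambda>e. integral {1..} (?f e)) \<longlongrightarrow> integral {1..} (?f 0)) (at_right 0)"
  proof (rule dominated_convergence_at_right[OF _ integrable_inverse_square[of 2]])
    show "?f e integrable_on {1..}" if "0 < e" for e
      by (rule improper_integral_limit(1)[OF exp_rem_reciprocal_continuous[OF that] integrable_inverse_square exp_rem_tail_bound[OF that]])
    show "\<bar>?f e w\<bar> \<le> 2 / w\<^sup>2" if "0 < e" "w \<in> {1..}" for e w
      using that by (intro exp_rem_tail_bound) auto
    fix w :: real assume "w \<in> {1..}"
    then have "0 < w\<^sup>2 / 2" "w\<^sup>2 / 2 \<le> exp_rem w" using exp_rem_lower(1)[of w] by auto
    then have "exp_rem w + 0 \<noteq> 0" by linarith
    then show "((\<lambda>e. ?f e w) \<longlongrightarrow> ?f 0 w) (at_right 0)" by (intro tendsto_intros) auto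
  qed
  ultimately have lim: "((\<lambda>e. integral {-a..1} (\<lambda>w. ?f e w - ?m e w) + integral {1..} (?f e)) \<longlongrightarrow>
      integral {-a..1} (\<lambda>w. ?f 0 w - ?m 0 w) + integral {1..} (?f 0)) (at_right 0)"
    by (rule tendsto_add)
  show ?thesis
  proof (rule exI, rule Lim_transform_eventually[OF lim])
    show "\<forall>\<^sub>F e in at_right 0. integral {-a..1} (\<lambda>w. ?f e w - ?m e w) + integral {1..} (?f e) =
        exp_rem_integral a e - (cubic_model_prim e 1 - cubic_model_prim e (-a))"
      using eventually_at_right_less[of 0]
    proof eventually_elim
      case (elim e)
      have "integral {-a..1} (\<lambda>w. ?f e w - ?m e w) = integral {-a..1} (?f e) - integral {-a..1} (?m e)"
        using fi[OF elim] mi[OF elim] by (intro Henstock_Kurzweil_Integration.integral_diff) auto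
      then show ?case using mi[OF elim] by (simp add: exp_rem_integral_def integral_unique)
    qed
  qed
qed

text \<open>With \<open>u = sqrt (2 * e)\<close> the prefactor is \<open>2 / u\<close>, and
  \<open>arctan (b / u)\<close> is \<open>pi / 2 - u / b\<close> up to smaller terms.\<close>

lemma arctan_reciprocal_asymp:
  assumes b: "0 < b"
  shows "((\<lambda>e. sqrt (2 / e) * arctan (b / sqrt (2 * e)) - sqrt (2 / e) * (pi / 2)) \<longlongrightarrow> - 2 / b) (at_right 0)"
proof -
  have "((\<lambda>u. 2 / u * arctan (b / u) - 2 / u * (pi / 2)) \<longlongrightarrow> - (2 * inverse b)) (at_right 0)"
    using b by real_asymp
  moreover have "filterlim (\<lambda>e::real. sqrt (2 * e)) (at_right 0) (at_right 0)"
    by real_asymp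
  ultimately have "((\<lambda>e. 2 / sqrt (2 * e) * arctan (b / sqrt (2 * e)) - 2 / sqrt (2 * e) * (pi / 2)) \<longlongrightarrow> - (2 * inverse b)) (at_right 0)"
    by (rule filterlim_compose)
  moreover have "2 / sqrt (2 * e) = sqrt (2 / e)" for e :: real
  proof -
    have "2 / sqrt (2 * e) = 2 / sqrt 2 / sqrt e" by (simp add: real_sqrt_mult)
    also have "2 / sqrt 2 = sqrt 2" by (rule real_div_sqrt) simp
    finally show ?thesis by (simp add: real_sqrt_divide)
  qed
  ultimately show ?thesis by (simp add: inverse_eq_divide)
qed

text \<open>The minimum \<open>w = 0\<close> lies strictly inside the interval. Each side
  contributes half of \<open>pi * sqrt (2 / e)\<close>, while the logarithms at both end points have
  finite limits.\<close>

lemma exp_rem_integral_interior: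
  assumes "0 < a" "a \<le> 1"
  shows "\<exists>c. ((\<lambda>e. exp_rem_integral a e - pi * sqrt (2 / e)) \<longlongrightarrow> c) (at_right 0)"
proof -
  have *: "((\<lambda>e. sqrt (2 / e) * arctan (b / sqrt (2 * e)) - sqrt (2 / e) * (pi / 2)) \<longlongrightarrow> - 2 / b) (at_right 0)"
    if "0 < b" for b :: real
    using that by (rule arctan_reciprocal_asymp)
  have **: "((\<lambda>e. ln (e + b\<^sup>2 / 2) + e / (e + b\<^sup>2 / 2)) \<longlongrightarrow> ln (0 + b\<^sup>2 / 2) + 0 / (0 + b\<^sup>2 / 2)) (at_right 0)"
    if "0 < b" for b :: real
    using that by (intro tendsto_intros) auto
  obtain c where c: "((\<lambda>e. exp_rem_integral a e - (cubic_model_prim e 1 - cubic_model_prim e (-a))) \<longlongrightarrow> c) (at_right 0)"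
    using exp_rem_integral_asymp[of a] assms by auto
  have "((\<lambda>e. (exp_rem_integral a e - (cubic_model_prim e 1 - cubic_model_prim e (-a)))
     + ((sqrt (2 / e) * arctan (1 / sqrt (2 * e)) - sqrt (2 / e) * (pi / 2))
     + (sqrt (2 / e) * arctan (a / sqrt (2 * e)) - sqrt (2 / e) * (pi / 2)))
     - (ln (e + 1\<^sup>2 / 2) + e / (e + 1\<^sup>2 / 2)) / 3 + (ln (e + a\<^sup>2 / 2) + e / (e + a\<^sup>2 / 2)) / 3) \<longlongrightarrow>
     c + (- 2 / 1 + - 2 / a) - (ln (0 + 1\<^sup>2 / 2) + 0 / (0 + 1\<^sup>2 / 2)) / 3 + (ln (0 + a\<^sup>2 / 2) + 0 / (0 + a\<^sup>2 / 2)) / 3) (at_right 0)"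
    using assms by (intro tendsto_intros c * **) auto
  moreover have "(\<lambda>e. (exp_rem_integral a e - (cubic_model_prim e 1 - cubic_model_prim e (-a)))
     + ((sqrt (2 / e) * arctan (1 / sqrt (2 * e)) - sqrt (2 / e) * (pi / 2))
     + (sqrt (2 / e) * arctan (a / sqrt (2 * e)) - sqrt (2 / e) * (pi / 2)))
     - (ln (e + 1\<^sup>2 / 2) + e / (e + 1\<^sup>2 / 2)) / 3 + (ln (e + a\<^sup>2 / 2) + e / (e + a\<^sup>2 / 2)) / 3)
    = (\<lambda>e. exp_rem_integral a e - pi * sqrt (2 / e))"
    by (simp add: fun_eq_iff cubic_model_prim_def arctan_minus algebra_simps add_divide_distrib)
  ultimately show ?thesis by auto
qed

text \<open>The minimum is now the lower end point: only one half of the main term appears, and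
  \<open>cubic_model_prim e 0 = - (ln e + 1) / 3\<close> leaves a logarithm uncompensated.\<close>

lemma exp_rem_integral_boundary:
  "\<exists>c. ((\<lambda>e. exp_rem_integral 0 e - (pi / sqrt 2 * e powr (- 1 / 2) + ln e / 3)) \<longlongrightarrow> c) (at_right 0)"
proof -
  obtain c where c: "((\<lambda>e. exp_rem_integral 0 e - (cubic_model_prim e 1 - cubic_model_prim e (-0))) \<longlongrightarrow> c) (at_right 0)"
    using exp_rem_integral_asymp[of 0] by auto
  have *: "((\<lambda>e. sqrt (2 / e) * arctan (1 / sqrt (2 * e)) - (pi / sqrt 2) * e powr (- 1 / 2)) \<longlongrightarrow> - 2) (at_right 0)"
  proof (rule Lim_transform_eventually)
    show "((\<lambda>e. sqrt (2 / e) * arctan (1 / sqrt (2 * e)) - sqrt (2 / e) * (pi / 2)) \<longlongrightarrow> - 2) (at_right 0)"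
      using arctan_reciprocal_asymp[of 1] by simp
    show "\<forall>\<^sub>F e in at_right 0. sqrt (2 / e) * arctan (1 / sqrt (2 * e)) - sqrt (2 / e) * (pi / 2) =
        sqrt (2 / e) * arctan (1 / sqrt (2 * e)) - pi / sqrt 2 * e powr (- 1 / 2)"
      using eventually_at_right_less[of 0]
    proof eventually_elim
      case (elim e)
      have "e powr (- 1 / 2) = 1 / sqrt e"
        using elim by (simp add: powr_minus_divide powr_half_sqrt)
      moreover have "sqrt (2 / e) * (pi / 2) = pi * (sqrt 2 / 2) * (1 / sqrt e)"
        by (simp add: real_sqrt_divide mult.commute)
      moreover have "sqrt 2 / 2 = 1 / sqrt 2" by (simp add: divide_simps)
      ultimately show ?case by (simp only:) simp
    qed
  qed
  have **: "((\<lambda>e. ln (e + 1\<^sup>2 / 2) + e / (e + 1\<^sup>2 / 2)) \<longlongrightarrow> ln (0 + 1\<^sup>2 / 2) + 0 / (0 + 1\<^sup>2 / 2)) (at_right (0::real))"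
    by (intro tendsto_intros) auto
  have "((\<lambda>e. (exp_rem_integral 0 e - (cubic_model_prim e 1 - cubic_model_prim e (-0)))
     + (sqrt (2 / e) * arctan (1 / sqrt (2 * e)) - (pi / sqrt 2) * e powr (- 1 / 2))
     - (ln (e + 1\<^sup>2 / 2) + e / (e + 1\<^sup>2 / 2)) / 3 + 1 / 3) \<longlongrightarrow>
     c + - 2 - (ln (0 + 1\<^sup>2 / 2) + 0 / (0 + 1\<^sup>2 / 2)) / 3 + 1 / 3) (at_right 0)"
    by (intro tendsto_intros c * **) auto
  note lim = this
  show ?thesis
  proof (rule exI, rule Lim_transform_eventually[OF lim])
    show "\<forall>\<^sub>F e in at_right 0. (exp_rem_integral 0 e - (cubic_model_prim e 1 - cubic_model_prim e (-0)))
     + (sqrt (2 / e) * arctan (1 / sqrt (2 * e)) - (pi / sqrt 2) * e powr (- 1 / 2))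
     - (ln (e + 1\<^sup>2 / 2) + e / (e + 1\<^sup>2 / 2)) / 3 + 1 / 3 =
     exp_rem_integral 0 e - (pi / sqrt 2 * e powr (- 1 / 2) + ln e / 3)"
      using eventually_at_right_less[of 0]
      by eventually_elim (simp add: cubic_model_prim_def diff_divide_distrib add_divide_distrib)
  qed
qed

text \<open>For \<open>l < 1\<close> the denominator \<open>D\<close> has a simple zero in the limit, and \<open>D' / D\<close> gives the logarithm.\<close>

lemma linear_reciprocal_integral_asymp:
  fixes l :: real
  assumes l: "0 < l" "l < 1"
  defines "D \<equiv> \<lambda>e x. exp x - 1 - l * x + e"
  shows "\<exists>K c. (\<forall>e>0. ((\<lambda>b. integral {0..b} (\<lambda>x. 1 / D e x)) \<longlongrightarrow> K e) at_top) \<and>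
     ((\<lambda>e. K e + ln e / (1 - l)) \<longlongrightarrow> c) (at_right 0)"
proof -
  define f where "f = (\<lambda>e x. 1 / D e x)"
  \<comment> \<open>A multiple of \<open>D' / D\<close>, normalized so that its numerator is 1 at
    \<open>x = 0\<close>, the zero of the limiting \<open>D\<close>. Then \<open>f - m\<close> has a
    numerator vanishing there.\<close>
  define m where "m = (\<lambda>e x. (exp x - l) / (1 - l) / D e x)"
  have D1: "(1 - l) * x + e \<le> D e x" for x e
    using exp_ge_add_one_self[of x] by (simp add: D_def algebra_simps)
  have D2: "x\<^sup>2 / 2 \<le> D e x" if "0 \<le> x" "0 \<le> e" for x e
  proof -
    have "l * x \<le> x" using l that by (simp add: mult_left_le_one_le)
    then show ?thesis using exp_rem_lower(1)[of x] that by (simp add: D_def exp_rem_def)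
  qed
  have Dpos: "0 < D e x" if "0 \<le> x" "0 < e" for x e
    using D1[of x e] that l mult_nonneg_nonneg[of "1 - l" x] by linarith
  have Dcont: "continuous_on S (D e)" for S e unfolding D_def by (intro continuous_intros)
  have fcont: "continuous_on {0..} (f e)" if "0 < e" for e
    unfolding f_def using Dpos[OF _ that] by (intro continuous_intros Dcont) (auto simp: less_imp_neq[symmetric])
  have fi: "f e integrable_on {0..b}" if "0 < e" for e b
    by (intro integrable_continuous_real continuous_on_subset[OF fcont[OF that]]) auto
  have f_tail: "\<bar>f e x\<bar> \<le> 2 / x\<^sup>2" if "0 < e" "1 \<le> x" for e x
  proof -
    have "x\<^sup>2 / 2 \<le> D e x" "0 < x\<^sup>2 / 2" using D2[of x e] that by auto
    then have "1 / D e x \<le> 1 / (x\<^sup>2 / 2)" by (intro divide_left_mono mult_pos_pos) linarith+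
    moreover have "0 < D e x" using Dpos that by simp
    ultimately show ?thesis by (simp add: f_def)
  qed
  define K where "K = (\<lambda>e. integral {0..1} (f e) + integral {1..} (f e))"
  have K: "((\<lambda>b. integral {0..b} (f e)) \<longlongrightarrow> K e) at_top" if e: "0 < e" for e
  proof -
    have "((\<lambda>b. integral {0..1} (f e) + integral {1..b} (f e)) \<longlongrightarrow> K e) at_top"
      unfolding K_def
      by (intro tendsto_add tendsto_const improper_integral_limit(2)[OF continuous_on_subset[OF fcont[OF e]] integrable_inverse_square[of 2]]
         f_tail[OF e]) auto
    moreover have "\<forall>\<^sub>F b in at_top. integral {0..1} (f e) + integral {1..b} (f e) = integral {0..b} (f e)"
      using eventually_ge_at_top[of 1]
      by eventually_elim (auto intro!: Henstock_Kurzweil_Integration.integral_combine fi[OF e])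
    ultimately show ?thesis by (rule Lim_transform_eventually)
  qed
  have mi: "(m e has_integral (ln (D e 1) / (1 - l) - ln e / (1 - l))) {0..1}" if e: "0 < e" for e
  proof -
    have "(m e has_integral (ln (D e 1) / (1 - l) - ln (D e 0) / (1 - l))) {0..1}"
    proof (rule fundamental_theorem_of_calculus)
      fix x :: real assume x: "x \<in> {0..1}"
      have "(D e has_real_derivative (exp x - l)) (at x within {0..1})"
        unfolding D_def by (auto intro!: derivative_eq_intros)
      then have "((\<lambda>x. ln (D e x)) has_real_derivative inverse (D e x) * (exp x - l)) (at x within {0..1})"
        using Dpos[of x e] x e by (intro DERIV_chain'[OF _ DERIV_ln]) auto
      from DERIV_cdivide[OF this, of "1 - l"]
      show "((\<lambda>x. ln (D e x) / (1 - l)) has_vector_derivative m e x) (at x within {0..1})"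
        by (simp add: has_real_derivative_iff_has_vector_derivative m_def field_simps)
    qed simp
    then show ?thesis by (simp add: D_def)
  qed
  have diff: "f e x - m e x = (1 - exp x) / (1 - l) / D e x" for e x
  proof -
    have "(1 - exp x) / (1 - l) = 1 - (exp x - l) / (1 - l)" using l by (simp add: field_simps)
    moreover have "f e x - m e x = (1 - (exp x - l) / (1 - l)) / D e x"
      unfolding f_def m_def by (rule diff_divide_distrib[symmetric])
    ultimately show ?thesis by (simp only:)
  qed
  have "((\<lambda>e. integral {0..1} (\<lambda>x. f e x - m e x)) \<longlongrightarrow> integral {0..1} (\<lambda>x. f 0 x - m 0 x)) (at_right 0)"
  proof (rule dominated_convergence_at_right[where h="\<lambda>_. 3 / (1 - l)\<^sup>2"])
    show "(\<lambda>x. f e x - m e x) integrable_on {0..1}" if "0 < e" for e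
      using fi[OF that] mi[OF that] by (auto intro: integrable_diff)
    \<comment> \<open>On the unit interval \<open>exp x - 1 \<le> 3 x\<close>, while
      \<open>D e x\<close> is at least \<open>(1 - l) x\<close>; the factor \<open>x\<close>
      cancels.\<close>
    show "\<bar>f e x - m e x\<bar> \<le> 3 / (1 - l)\<^sup>2" if e: "0 < e" and x: "x \<in> {0..1}" for e x
    proof -
      have "exp x - 1 \<le> 3 * x"
      proof -
        have "1 - x \<le> exp (- x)" using exp_ge_add_one_self[of "- x"] by simp
        then have "exp x * (1 - x) \<le> exp x * exp (- x)" by (intro mult_left_mono) auto
        then have "exp x - 1 \<le> exp x * x" by (simp add: exp_minus algebra_simps)
        also have "exp x \<le> 3" using x exp_le by (meson atLeastAtMost_iff exp_le_cancel_iff order_trans)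
        then have "exp x * x \<le> 3 * x" using x by (intro mult_right_mono) auto
        finally show ?thesis .
      qed
      moreover have "(1 - l) * x \<le> D e x" using D1[of x e] e by linarith
      ultimately have "(exp x - 1) * (1 - l) \<le> 3 * D e x"
        using mult_right_mono[of "exp x - 1" "3 * x" "1 - l"] l by (simp add: algebra_simps)
      then have "(exp x - 1) / (1 - l) / D e x \<le> 3 / (1 - l)\<^sup>2"
        using l Dpos[of x e] e x by (simp add: divide_simps power2_eq_square mult.commute)
      moreover have "\<bar>f e x - m e x\<bar> = (exp x - 1) / (1 - l) / D e x"
        unfolding diff using l Dpos[of x e] e x by (simp add: abs_divide)
      ultimately show ?thesis by simp
    qed
    fix x :: real assume x: "x \<in> {0..1}"
    show "((\<lambda>e. f e x - m e x) \<longlongrightarrow> f 0 x - m 0 x) (at_right 0)"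
    proof (cases "x = 0")
      case True
      then show ?thesis unfolding diff by simp
    next
      case False
      then have "0 < (1 - l) * x" using x l by simp
      then have "D 0 x \<noteq> 0" using D1[of x 0] by linarith
      then show ?thesis using l unfolding f_def m_def D_def by (intro tendsto_intros) auto
    qed
  qed auto
  moreover have "((\<lambda>e. integral {1..} (f e)) \<longlongrightarrow> integral {1..} (f 0)) (at_right 0)"
  proof (rule dominated_convergence_at_right[OF _ integrable_inverse_square[of 2]])
    show "f e integrable_on {1..}" if "0 < e" for e
      by (rule improper_integral_limit(1)[OF continuous_on_subset[OF fcont[OF that]] integrable_inverse_square f_tail[OF that]]) auto
    show "\<bar>f e x\<bar> \<le> 2 / x\<^sup>2" if "0 < e" "x \<in> {1..}" for e x
      using that by (intro f_tail) auto
    fix x :: real assume "x \<in> {1..}"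
    then have "0 < x\<^sup>2 / 2" "x\<^sup>2 / 2 \<le> D 0 x" using D2[of x 0] by auto
    then have "D 0 x \<noteq> 0" by linarith
    then show "((\<lambda>e. f e x) \<longlongrightarrow> f 0 x) (at_right 0)" unfolding f_def D_def by (intro tendsto_intros) auto
  qed
  moreover have "((\<lambda>e. ln (D e 1) / (1 - l)) \<longlongrightarrow> ln (D 0 1) / (1 - l)) (at_right 0)"
  proof -
    have "D 0 1 \<noteq> 0" using D2[of 1 0] by auto
    then show ?thesis using l unfolding D_def by (intro tendsto_intros) auto
  qed
  ultimately have lim: "((\<lambda>e. integral {0..1} (\<lambda>x. f e x - m e x) + integral {1..} (f e) + ln (D e 1) / (1 - l)) \<longlongrightarrow>
      integral {0..1} (\<lambda>x. f 0 x - m 0 x) + integral {1..} (f 0) + ln (D 0 1) / (1 - l)) (at_right 0)"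
    by (intro tendsto_add)
  have "((\<lambda>e. K e + ln e / (1 - l)) \<longlongrightarrow>
      integral {0..1} (\<lambda>x. f 0 x - m 0 x) + integral {1..} (f 0) + ln (D 0 1) / (1 - l)) (at_right 0)"
  proof (rule Lim_transform_eventually[OF lim])
    show "\<forall>\<^sub>F e in at_right 0. integral {0..1} (\<lambda>x. f e x - m e x) + integral {1..} (f e) + ln (D e 1) / (1 - l) =
        K e + ln e / (1 - l)"
      using eventually_at_right_less[of 0]
    proof eventually_elim
      case (elim e)
      have "integral {0..1} (\<lambda>x. f e x - m e x) = integral {0..1} (f e) - integral {0..1} (m e)"
        using fi[OF elim] mi[OF elim] by (intro Henstock_Kurzweil_Integration.integral_diff) auto
      then show ?case using mi[OF elim] by (simp add: K_def integral_unique)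
    qed
  qed
  then show ?thesis using K unfolding f_def by blast
qed

subsection \<open>The free energy\<close>

lemma tendsto_imp_asymp_equiv_mult_const:
  fixes f g h :: "'a \<Rightarrow> real"
  assumes "eventually (\<lambda>x. f x = h x * g x) F" "(h \<longlongrightarrow> C) F" "C \<noteq> 0"
  shows "f \<sim>[F] (\<lambda>x. C * g x)"
proof -
  have "(\<lambda>x. h x * g x) \<sim>[F] (\<lambda>x. C * g x)"
    using assms by (intro asymp_equiv_mult tendsto_imp_asymp_equiv_const asymp_equiv_refl)
  moreover have "f \<sim>[F] (\<lambda>x. h x * g x)"
    using assms(1) by (rule asymp_equiv_refl_ev)
  ultimately show ?thesis using asymp_equiv_trans by blast
qed

section \<open>The range from \<open>1\<close> to \<open>exp 1\<close>: critical parameter and exact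
  formula\<close>

context
  fixes l :: real
  assumes l: "1 \<le> l" "l < exp 1"
begin

lemma ln_l: "0 \<le> ln l" "ln l < 1"
  using l ln_less_cancel_iff[of l "exp 1"] by auto

text \<open>At the critical parameter the value \<open>D 0\<close> is
  \<open>1 - (l - l * ln l) = l * exp_rem (- ln l)\<close>, which is nonnegative and vanishes only
  if \<open>ln l = 0\<close>.\<close>

lemma critical_parameter_bounds: "0 < l - l * ln l" "l - l * ln l \<le> 1" "1 < l \<Longrightarrow> l - l * ln l < 1"
proof -
  show "0 < l - l * ln l" using ln_l l by simp
  have "exp (- ln l) * l = 1" using l by (simp add: exp_minus)
  then have *: "1 - (l - l * ln l) = exp_rem (- ln l) * l"
    by (simp add: exp_rem_def algebra_simps)
  have "0 \<le> exp_rem (- ln l) * l" using exp_rem_nonneg l by simp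
  with * show "l - l * ln l \<le> 1" by linarith
  assume "1 < l"
  then have "0 < (- ln l)\<^sup>2 / 3" by simp
  moreover have "(- ln l)\<^sup>2 / 3 \<le> exp_rem (- ln l)" using ln_l by (intro exp_rem_lower) auto
  ultimately have "0 < exp_rem (- ln l)" by linarith
  then have "0 < exp_rem (- ln l) * l" using l by simp
  with * show "l - l * ln l < 1" by linarith
qed

text \<open>The factor \<open>l\<close> extracted from \<open>D\<close> by the shift cancels the
  \<open>l\<close> in the exponent of \<open>free_energy_subcritical\<close>.\<close>

lemma free_energy_exp_rem:
  assumes p: "0 \<le> p" "p < l - l * ln l" and \<mu>: "DR_model (init_law p l) \<mu>"
  shows "free_energy \<mu> = ennreal ((1 - p) / l * exp (- exp_rem_integral (ln l) ((l - l * ln l - p) / l)))"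
proof -
  define e where "e = (l - l * ln l - p) / l"
  have e: "0 < e" using p l by (simp add: e_def)
  have p1: "p < 1" using p critical_parameter_bounds by linarith
  have D: "exp x - p - l * x = l * (exp_rem (x - ln l) + e)" for x
    using l by (simp add: e_def exp_rem_def exp_diff field_simps)
  have pos: "0 < exp x - p - l * x" for x
    unfolding D using e exp_rem_nonneg[of "x - ln l"] l by simp
  let ?f = "\<lambda>w. 1 / (exp_rem w + e)"
  have eq: "integral {0..b} (\<lambda>x. 1 / (exp x - p - l * x)) = 1 / l * integral {- ln l..b - ln l} ?f" for b
  proof -
    have "integral {0..b} (\<lambda>x. 1 / (exp x - p - l * x)) = integral {0..b} (\<lambda>x. 1 / l * ?f (x - ln l))"
      unfolding D by simp
    also have "\<dots> = 1 / l * integral {0..b} (\<lambda>x. ?f (x - ln l))"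
      by (rule Henstock_Kurzweil_Integration.integral_mult_right)
    also have "integral {0..b} (\<lambda>x. ?f (x - ln l)) = integral {- ln l..b - ln l} ?f"
      using integral_shift[of 0 "- ln l" b ?f] exp_rem_reciprocal_continuous[OF e] by (simp add: o_def)
    finally show ?thesis .
  qed
  have "((\<lambda>b. integral {- ln l..b - ln l} ?f) \<longlongrightarrow> exp_rem_integral (ln l) e) at_top"
  proof (rule filterlim_compose[OF exp_rem_integral_limit[OF _ e]])
    show "filterlim (\<lambda>b. b - ln l) at_top at_top"
      by real_asymp
  qed (use ln_l in auto)
  then have "((\<lambda>b. integral {0..b} (\<lambda>x. 1 / (exp x - p - l * x))) \<longlongrightarrow> 1 / l * exp_rem_integral (ln l) e) at_top"
    unfolding eq by (intro tendsto_mult tendsto_const)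
  from free_energy_subcritical[OF p(1) p1 _ pos \<mu> this] show ?thesis
    using l by (simp add: e_def)
qed

lemma distance_at_right: "filterlim (\<lambda>p. (l - l * ln l - p) / l) (at_right 0) (at_left (l - l * ln l))"
proof (rule tendsto_imp_filterlim_at_right)
  have "((\<lambda>p. (l - l * ln l - p) / l) \<longlongrightarrow> (l - l * ln l - (l - l * ln l)) / l) (at_left (l - l * ln l))"
    using l by (intro tendsto_intros) auto
  then show "((\<lambda>p. (l - l * ln l - p) / l) \<longlongrightarrow> 0) (at_left (l - l * ln l))" by simp
  show "\<forall>\<^sub>F p in at_left (l - l * ln l). 0 < (l - l * ln l - p) / l"
    using eventually_at_left_real[OF critical_parameter_bounds(1)]
    by eventually_elim (use l in auto)
qed

end

theorem theorem1p10:
  fixes l :: real and \<mu> :: "real \<Rightarrow> real \<Rightarrow> real measure"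
  assumes "0 < l" and "l < exp 1"
    and DR: "\<And>p. p \<in> {0..1} \<Longrightarrow> DR_model (init_law p l) (\<mu> p)"
  defines "F \<equiv> \<lambda>p. free_energy (\<mu> p)"
    and "p_c \<equiv> l - l * ln l"
  shows "(1 < l \<longrightarrow>
            (\<exists>C>0. (\<lambda>p. enn2real (F p)) \<sim>[at_left p_c]
               (\<lambda>p. indicator {..<p_c} p * (C * exp (- pi * sqrt (2 * l) * (p_c - p) powr (- 1 / 2))))))
       \<and> (l = 1 \<longrightarrow> F 1 = 0 \<and>
            (\<exists>C>0. (\<lambda>p. enn2real (F p)) \<sim>[at_left 1]
               (\<lambda>p. C * (1 - p) powr (2 / 3) * exp (- (pi / sqrt 2) * (1 - p) powr (- 1 / 2)))))
       \<and> (l < 1 \<longrightarrow> F 1 = 0 \<and>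
            (\<exists>C>0. (\<lambda>p. enn2real (F p)) \<sim>[at_left 1]
               (\<lambda>p. C * (1 - p) powr (1 / (1 - l)))))"
proof (intro conjI impI)
  show "F 1 = 0" "F 1 = 0"
    unfolding F_def using free_energy_point_mass[OF \<open>0 < l\<close> DR] by simp_all
next
  assume l1: "1 < l"
  then have l: "1 \<le> l" "l < exp 1" using assms(2) by auto
  note pc = critical_parameter_bounds[OF l, folded p_c_def]
  obtain c where c: "((\<lambda>e. exp_rem_integral (ln l) e - pi * sqrt (2 / e)) \<longlongrightarrow> c) (at_right 0)"
    using exp_rem_integral_interior[of "ln l"] ln_l[OF l] l1 by auto
  define S where "S = (\<lambda>p. exp_rem_integral (ln l) ((p_c - p) / l) - pi * sqrt (2 / ((p_c - p) / l)))"
  have S: "(S \<longlongrightarrow> c) (at_left p_c)"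
    unfolding S_def p_c_def by (rule filterlim_compose[OF c distance_at_right[OF l]])
  \<comment> \<open>The prefactor \<open>(1 - p) / l\<close> has a positive limit as
    \<open>p_c < 1\<close>, and \<open>c\<close> is the constant term of the reciprocal
    integral.\<close>
  define C where "C = (1 - p_c) / l * exp (- c)"
  show "\<exists>C>0. (\<lambda>p. enn2real (F p)) \<sim>[at_left p_c]
     (\<lambda>p. indicator {..<p_c} p * (C * exp (- pi * sqrt (2 * l) * (p_c - p) powr (- 1 / 2))))"
  proof (intro exI conjI)
    show "0 < C" using pc(3)[OF l1] l by (simp add: C_def)
    have "(\<lambda>p. enn2real (F p)) \<sim>[at_left p_c]
       (\<lambda>p. C * (indicator {..<p_c} p * exp (- pi * sqrt (2 * l) * (p_c - p) powr (- 1 / 2))))"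
    proof (rule tendsto_imp_asymp_equiv_mult_const)
      show "((\<lambda>p. (1 - p) / l * exp (- S p)) \<longlongrightarrow> C) (at_left p_c)"
        unfolding C_def using l by (intro tendsto_intros S) auto
      show "C \<noteq> 0" using \<open>0 < C\<close> by simp
      show "\<forall>\<^sub>F p in at_left p_c. enn2real (F p) =
          (1 - p) / l * exp (- S p) * (indicator {..<p_c} p * exp (- pi * sqrt (2 * l) * (p_c - p) powr (- 1 / 2)))"
        using eventually_at_left_real[OF pc(1)]
      proof eventually_elim
        case (elim p)
        then have p: "0 < p" "p < p_c" by auto
        have "F p = ennreal ((1 - p) / l * exp (- exp_rem_integral (ln l) ((p_c - p) / l)))"
          unfolding F_def p_c_def using p pc DR[of p] by (intro free_energy_exp_rem[OF l]) (auto simp: p_c_def)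
        then have "enn2real (F p) = (1 - p) / l * exp (- exp_rem_integral (ln l) ((p_c - p) / l))"
          using p pc l by simp
        also have "exp_rem_integral (ln l) ((p_c - p) / l) = S p + pi * sqrt (2 * l) * (p_c - p) powr (- 1 / 2)"
        proof -
          have "sqrt (2 / ((p_c - p) / l)) = sqrt (2 * l) * (p_c - p) powr (- 1 / 2)"
            using p by (simp add: powr_minus_divide powr_half_sqrt real_sqrt_divide)
          then show ?thesis by (simp add: S_def)
        qed
        finally have "enn2real (F p) = (1 - p) / l * exp (- S p + - pi * sqrt (2 * l) * (p_c - p) powr (- 1 / 2))"
          by simp
        then show ?case using p unfolding exp_add by simp
      qed
    qed
    then show "(\<lambda>p. enn2real (F p)) \<sim>[at_left p_c]
       (\<lambda>p. indicator {..<p_c} p * (C * exp (- pi * sqrt (2 * l) * (p_c - p) powr (- 1 / 2))))"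
      by (simp add: mult.left_commute)
  qed
next
  assume l1: "l = 1"
  then have l: "1 \<le> l" "l < exp 1" using assms(2) by auto
  obtain c where c: "((\<lambda>e. exp_rem_integral 0 e - (pi / sqrt 2 * e powr (- 1 / 2) + ln e / 3)) \<longlongrightarrow> c) (at_right 0)"
    using exp_rem_integral_boundary by auto
  define S where "S = (\<lambda>p. exp_rem_integral 0 (1 - p) - (pi / sqrt 2 * (1 - p) powr (- 1 / 2) + ln (1 - p) / 3))"
  have S: "(S \<longlongrightarrow> c) (at_left 1)"
    unfolding S_def using filterlim_compose[OF c distance_at_right[OF l]] by (simp add: l1)
  show "\<exists>C>0. (\<lambda>p. enn2real (F p)) \<sim>[at_left 1]
     (\<lambda>p. C * (1 - p) powr (2 / 3) * exp (- (pi / sqrt 2) * (1 - p) powr (- 1 / 2)))"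
  proof (intro exI conjI)
    show "0 < exp (- c)" by simp
    have "(\<lambda>p. enn2real (F p)) \<sim>[at_left 1]
       (\<lambda>p. exp (- c) * ((1 - p) powr (2 / 3) * exp (- (pi / sqrt 2) * (1 - p) powr (- 1 / 2))))"
    proof (rule tendsto_imp_asymp_equiv_mult_const)
      show "((\<lambda>p. exp (- S p)) \<longlongrightarrow> exp (- c)) (at_left 1)" by (intro tendsto_intros S)
      show "\<forall>\<^sub>F p in at_left 1. enn2real (F p) =
          exp (- S p) * ((1 - p) powr (2 / 3) * exp (- (pi / sqrt 2) * (1 - p) powr (- 1 / 2)))"
        using eventually_at_left_real[OF zero_less_one]
      proof eventually_elim
        case (elim p)
        then have p: "0 < p" "p < 1" by auto
        define q where "q = pi / sqrt 2 * (1 - p) powr (- 1 / 2)"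
        have "F p = ennreal ((1 - p) / l * exp (- exp_rem_integral (ln l) ((l - l * ln l - p) / l)))"
          unfolding F_def using p DR[of p] by (intro free_energy_exp_rem[OF l]) (auto simp: l1)
        then have "enn2real (F p) = (1 - p) * exp (- exp_rem_integral 0 (1 - p))"
          using p by (simp add: l1)
        also have "exp_rem_integral 0 (1 - p) = S p + q + ln (1 - p) / 3" by (simp add: S_def q_def)
        also have "(1 - p) * exp (- (S p + q + ln (1 - p) / 3)) = exp (ln (1 - p)) * exp (- (S p + q + ln (1 - p) / 3))"
          using p by simp
        \<comment> \<open>The power \<open>2 / 3\<close> is 1 from the prefactor
          \<open>1 - p\<close> minus \<open>1 / 3\<close> from the logarithm in the boundary
          asymptotics.\<close>
        also have "\<dots> = exp (- S p) * ((1 - p) powr (2 / 3) * exp (- q))"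
        proof -
          have "ln (1 - p) + - (S p + q + ln (1 - p) / 3) = - S p + (2 / 3 * ln (1 - p) + - q)" by simp
          moreover have "(1 - p) powr (2 / 3) = exp (2 / 3 * ln (1 - p))" using p by (simp add: powr_def)
          ultimately show ?thesis by (simp only: exp_add[symmetric])
        qed
        finally show ?case by (simp add: q_def)
      qed
    qed simp
    then show "(\<lambda>p. enn2real (F p)) \<sim>[at_left 1]
       (\<lambda>p. exp (- c) * (1 - p) powr (2 / 3) * exp (- (pi / sqrt 2) * (1 - p) powr (- 1 / 2)))"
      by (simp add: mult.assoc)
  qed
next
  assume l1: "l < 1"
  obtain K c where K: "\<And>e. 0 < e \<Longrightarrow> ((\<lambda>b. integral {0..b} (\<lambda>x. 1 / (exp x - 1 - l * x + e))) \<longlongrightarrow> K e) at_top"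
    and c: "((\<lambda>e. K e + ln e / (1 - l)) \<longlongrightarrow> c) (at_right 0)"
    using linear_reciprocal_integral_asymp[OF \<open>0 < l\<close> l1] by blast
  have "filterlim (\<lambda>p::real. 1 - p) (at_right 0) (at_left 1)" by real_asymp
  from filterlim_compose[OF c this]
  have S: "((\<lambda>p. K (1 - p) + ln (1 - p) / (1 - l)) \<longlongrightarrow> c) (at_left 1)" .
  show "\<exists>C>0. (\<lambda>p. enn2real (F p)) \<sim>[at_left 1] (\<lambda>p. C * (1 - p) powr (1 / (1 - l)))"
  proof (intro exI conjI)
    show "0 < 1 / l * exp (- l * c)" using \<open>0 < l\<close> by simp
    show "(\<lambda>p. enn2real (F p)) \<sim>[at_left 1] (\<lambda>p. 1 / l * exp (- l * c) * (1 - p) powr (1 / (1 - l)))"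
    proof (rule tendsto_imp_asymp_equiv_mult_const)
      show "((\<lambda>p. 1 / l * exp (- l * (K (1 - p) + ln (1 - p) / (1 - l)))) \<longlongrightarrow> 1 / l * exp (- l * c)) (at_left 1)"
        by (intro tendsto_intros S)
      show "\<forall>\<^sub>F p in at_left 1. enn2real (F p) =
          1 / l * exp (- l * (K (1 - p) + ln (1 - p) / (1 - l))) * (1 - p) powr (1 / (1 - l))"
        using eventually_at_left_real[OF zero_less_one]
      proof eventually_elim
        case (elim p)
        then have p: "0 < p" "p < 1" by auto
        have D: "exp x - 1 - l * x + (1 - p) = exp x - p - l * x" for x by simp
        have pos: "0 < exp x - p - l * x" if "0 \<le> x" for x
        proof -
          have "l * x \<le> 1 * x" using that l1 by (intro mult_right_mono) auto
          then show ?thesis using exp_ge_add_one_self[of x] p by linarith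
        qed
        have "((\<lambda>b. integral {0..b} (\<lambda>x. 1 / (exp x - p - l * x))) \<longlongrightarrow> K (1 - p)) at_top"
          using K[of "1 - p"] p unfolding D by simp
        then have "F p = ennreal ((1 - p) / l * exp (- l * K (1 - p)))"
          unfolding F_def using p \<open>0 < l\<close> pos DR[of p] by (intro free_energy_subcritical) auto
        then have "enn2real (F p) = 1 / l * (exp (ln (1 - p)) * exp (- l * K (1 - p)))"
          using p \<open>0 < l\<close> by simp
        also have "exp (ln (1 - p)) * exp (- l * K (1 - p)) =
            exp (- l * (K (1 - p) + ln (1 - p) / (1 - l))) * (1 - p) powr (1 / (1 - l))"
        proof -
          \<comment> \<open>The exponent arises as \<open>1 / (1 - l) = 1 + l / (1 - l)\<close>: 1
            from the prefactor and \<open>l / (1 - l)\<close> from the logarithmic divergence of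
            \<open>K\<close>.\<close>
          have "ln (1 - p) = - l * (ln (1 - p) / (1 - l)) + 1 / (1 - l) * ln (1 - p)"
          proof -
            have "- l * (y / (1 - l)) + 1 / (1 - l) * y = (1 - l) * (y / (1 - l))" for y :: real
              by (simp only: left_diff_distrib mult_1 times_divide_eq_left)
            then show ?thesis using l1 by simp
          qed
          then have "ln (1 - p) + - l * K (1 - p) =
             - l * (K (1 - p) + ln (1 - p) / (1 - l)) + 1 / (1 - l) * ln (1 - p)"
            by (simp add: distrib_left)
          moreover have "(1 - p) powr (1 / (1 - l)) = exp (1 / (1 - l) * ln (1 - p))"
            using p by (simp add: powr_def)
          ultimately show ?thesis by (simp only: exp_add[symmetric])
        qed
        finally show ?case by simp
      qed
      show "1 / l * exp (- l * c) \<noteq> 0" using \<open>0 < l\<close> by simp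
    qed
  qed
qed

end
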